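(* Consider problem (P), the Hilbert space $H$, the operator $A$, the functions $\phi_\lambda,\chi_\lambda$ and the characteristic function $\omega(\lambda)$ described in the context. Let $\lambda\in\mathbb{C}$ not be an eigenvalue of $A$, and let $F=\begin{pmatrix}f(x)\\ f_1\end{pmatrix}\in H$. Then the solution $U=\begin{pmatrix}u(x)\\ R'(u)\end{pmatrix}\in D(A)$ of $(\lambda \mathrm{I}-A)U=F$ (with $\mathrm{I}$ the identity operator) is $U=(\lambda \mathrm{I}-A)^{-1}F$ with first component $$u(x,\lambda)=\int_a^{\theta_{-\varepsilon}}G(x,y;\lambda)f(y)\,dy+\frac1{D_1}\int_{\theta_{-\varepsilon}}^{\theta_{+\varepsilon}}G(x,y;\lambda)f(y)\,dy+\frac1{D_1D_2}\int_{\theta_{+\varepsilon}}^{b}G(x,y;\lambda)f(y)\,dy+\frac{f_1\,\phi_\lambda(x)}{D_1D_2\,\omega(\lambda)},$$ $x\in I$, where the Green's function of (P) is $$G(x,y;\lambda)=\begin{cases}\dfrac{\phi_\lambda(y)\chi_\lambda(x)}{\omega(\lambda)}, & a\le y\le x\le b,\\[2mm] \dfrac{\phi_\lambda(x)\chi_\lambda(y)}{\omega(\lambda)}, & a\le x\le y\le b,\end{cases}\qquad x,y\neq\theta_{-\varepsilon},\theta_{+\varepsilon}.$$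
   Context: Setting. Let $a<b$ be real, $\theta=(a+b)/2$, $0<\varepsilon<(b-a)/2$, $\theta_{-\varepsilon}=\theta-\varepsilon$, $\theta_{+\varepsilon}=\theta+\varepsilon$, and $I=[a,\theta_{-\varepsilon})\cup(\theta_{-\varepsilon},\theta_{+\varepsilon})\cup(\theta_{+\varepsilon},b]$, $I_1=[a,\theta_{-\varepsilon}]$, $I_2=[\theta_{-\varepsilon},\theta_{+\varepsilon}]$, $I_3=[\theta_{+\varepsilon},b]$. Write $u(\theta_{\pm\varepsilon}+)$ and $u(\theta_{\pm\varepsilon}-)$ for the right and left limits of $u$ at the point $\theta_{\pm\varepsilon}$. Let $q:I\to\mathbb{R}$ be continuous on each of the three pieces of $I$ with finite one-sided limits at $\theta_{-\varepsilon}$ and $\theta_{+\varepsilon}$. Let $\beta_i,\alpha_i,\alpha_i',\mu_i,\mu_i',\eta_i,\eta_i'$ ($i=1,2$) be real numbers (primes on constants are part of the name) with $|\beta_1|+|\beta_2|\neq0$, $\rho:=\alpha_1'\alpha_2-\alpha_2'\alpha_1>0$, $D_1:=\mu_1\mu_2'-\mu_2\mu_1'>0$, $D_2:=\eta_1\eta_2'-\eta_2\eta_1'>0$. Problem (P), with spectral parameter $\lambda\in\mathbb{C}$, is the following: $$\tau(u):=-u''+q(x)u=\lambda u,\quad x\in I;$$ boundary conditions $\beta_1u(a)+\beta_2u'(a)=0$ and $\lambda R'(u)+R(u)=0$, where $R(u):=\alpha_1u(b)-\alpha_2u'(b)$ and $R'(u):=\alpha_1'u(b)-\alpha_2'u'(b)$;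 transmission conditions $$u(\theta_{-\varepsilon}+)=\mu_1u(\theta_{-\varepsilon}-)+\mu_2u'(\theta_{-\varepsilon}-),\quad u'(\theta_{-\varepsilon}+)=\mu_1'u(\theta_{-\varepsilon}-)+\mu_2'u'(\theta_{-\varepsilon}-),$$ $$u(\theta_{+\varepsilon}+)=\eta_1u(\theta_{+\varepsilon}-)+\eta_2u'(\theta_{+\varepsilon}-),\quad u'(\theta_{+\varepsilon}+)=\eta_1'u(\theta_{+\varepsilon}-)+\eta_2'u'(\theta_{+\varepsilon}-).$$ Operator. $H=L_2(a,b)\oplus\mathbb{C}$ with inner product, for $F=(f,f_1)$, $G=(g,g_1)$, $$\langle F,G\rangle_H=\int_a^{\theta_{-\varepsilon}}f\overline g\,dx+\frac1{D_1}\int_{\theta_{-\varepsilon}}^{\theta_{+\varepsilon}}f\overline g\,dx+\frac1{D_1D_2}\int_{\theta_{+\varepsilon}}^bf\overline g\,dx+\frac1{\rho D_1D_2}f_1\overline{g_1}.$$ $D(A)$ is the set of all $F=\begin{pmatrix}f\\ R'(f)\end{pmatrix}\in H$ such that: on each $I_i$ ($i=1,2,3$) the restriction of $f$ to the interior, extended to the endpoints by one-sided limits, and its derivative are absolutely continuous; $\tau(f)\in L_2(a,b)$; $\beta_1f(a)+\beta_2f'(a)=0$; and $f$ satisfies the four transmission conditions. The operator $A:D(A)\to H$ is $A\begin{pmatrix}f\\ R'(f)\end{pmatrix}=\begin{pmatrix}\tau(f)\\ -R(f)\end{pmatrix}$. Solutions. $\phi_\lambda$ is the unique solution on $I$ of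 $\tau(u)=\lambda u$ with $u(a)=\beta_2$, $u'(a)=-\beta_1$ satisfying the four transmission conditions; $\chi_\lambda$ is the unique solution on $I$ of $\tau(u)=\lambda u$ with $u(b)=\alpha_2'\lambda+\alpha_2$, $u'(b)=\alpha_1'\lambda+\alpha_1$ satisfying the four transmission conditions. Let $\omega_i(\lambda)=\phi_\lambda\chi_\lambda'-\phi_\lambda'\chi_\lambda$ on $I_i$ (independent of $x\in I_i$; one-sided limits at endpoints); then $\omega(\lambda):=\omega_1(\lambda)=\frac1{D_1}\omega_2(\lambda)=\frac1{D_1D_2}\omega_3(\lambda)$. *)

theory Defs
  imports "HOL-Analysis.Analysis"
begin

section \<open>Data of the problem\<close>

text \<open>A prime on a constant is part of its name.\<close>

record SL_data =
  a_pt :: real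
  b_pt :: real
  eps :: real
  pot :: "real \<Rightarrow> real"
  beta1 :: real
  beta2 :: real
  alpha1 :: real
  alpha2 :: real
  alpha1' :: real
  alpha2' :: real
  mu1 :: real
  mu2 :: real
  mu1' :: real
  mu2' :: real
  eta1 :: real
  eta2 :: real
  eta1' :: real
  eta2' :: real

definition theta_m :: "SL_data \<Rightarrow> real" where
  "theta_m P = (a_pt P + b_pt P) / 2 - eps P"

definition theta_p :: "SL_data \<Rightarrow> real" where
  "theta_p P = (a_pt P + b_pt P) / 2 + eps P"

definition I_dom :: "SL_data \<Rightarrow> real set" where
  "I_dom P = {a_pt P..<theta_m P} \<union> {theta_m P<..<theta_p P} \<union> {theta_p P<..b_pt P}"

definition I1 :: "SL_data \<Rightarrow> real set" where
  "I1 P = {a_pt P..theta_m P}"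

definition I2 :: "SL_data \<Rightarrow> real set" where
  "I2 P = {theta_m P..theta_p P}"

definition I3 :: "SL_data \<Rightarrow> real set" where
  "I3 P = {theta_p P..b_pt P}"

definition rho :: "SL_data \<Rightarrow> real" where
  "rho P = alpha1' P * alpha2 P - alpha2' P * alpha1 P"

definition D1 :: "SL_data \<Rightarrow> real" where
  "D1 P = mu1 P * mu2' P - mu2 P * mu1' P"

definition D2 :: "SL_data \<Rightarrow> real" where
  "D2 P = eta1 P * eta2' P - eta2 P * eta1' P"

definition SL_problem :: "SL_data \<Rightarrow> bool" where
  "SL_problem P \<longleftrightarrow>
     a_pt P < b_pt P \<and> 0 < eps P \<and> eps P < (b_pt P - a_pt P) / 2 \<and>
     continuous_on {a_pt P..<theta_m P} (pot P) \<and>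
     continuous_on {theta_m P<..<theta_p P} (pot P) \<and>
     continuous_on {theta_p P<..b_pt P} (pot P) \<and>
     (\<exists>l. (pot P \<longlongrightarrow> l) (at_left (theta_m P))) \<and>
     (\<exists>l. (pot P \<longlongrightarrow> l) (at_right (theta_m P))) \<and>
     (\<exists>l. (pot P \<longlongrightarrow> l) (at_left (theta_p P))) \<and>
     (\<exists>l. (pot P \<longlongrightarrow> l) (at_right (theta_p P))) \<and>
     \<bar>beta1 P\<bar> + \<bar>beta2 P\<bar> \<noteq> 0 \<and>
     rho P > 0 \<and> D1 P > 0 \<and> D2 P > 0"


section \<open>Differential expression, boundary forms, transmission conditions\<close>

text \<open>Functions on I are total functions whose values off I are irrelevant. The derivative is taken
  within I: it is two-sided at inner points of I and one-sided at the endpoints \<open>a\<close> and \<open>b\<close>.\<close>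

definition der :: "SL_data \<Rightarrow> (real \<Rightarrow> complex) \<Rightarrow> real \<Rightarrow> complex" where
  "der P u x = vector_derivative u (at x within I_dom P)"

definition tau :: "SL_data \<Rightarrow> (real \<Rightarrow> complex) \<Rightarrow> real \<Rightarrow> complex" where
  "tau P u x = - der P (der P u) x + of_real (pot P x) * u x"

definition R_form :: "SL_data \<Rightarrow> (real \<Rightarrow> complex) \<Rightarrow> complex" where
  "R_form P u = of_real (alpha1 P) * u (b_pt P) - of_real (alpha2 P) * der P u (b_pt P)"

definition R'_form :: "SL_data \<Rightarrow> (real \<Rightarrow> complex) \<Rightarrow> complex" where
  "R'_form P u = of_real (alpha1' P) * u (b_pt P) - of_real (alpha2' P) * der P u (b_pt P)"

text \<open>The existence of the one-sided limits of \<open>u\<close> and \<open>u'\<close> is part of the condition.\<close>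

definition transmits ::
  "SL_data \<Rightarrow> real \<Rightarrow> real \<Rightarrow> real \<Rightarrow> real \<Rightarrow> real \<Rightarrow> (real \<Rightarrow> complex) \<Rightarrow> bool" where
  "transmits P t m1 m2 m1' m2' u \<longleftrightarrow>
     (\<exists>ul ul' ur ur'.
        (u \<longlongrightarrow> ul) (at_left t) \<and> (der P u \<longlongrightarrow> ul') (at_left t) \<and>
        (u \<longlongrightarrow> ur) (at_right t) \<and> (der P u \<longlongrightarrow> ur') (at_right t) \<and>
        ur = of_real m1 * ul + of_real m2 * ul' \<and>
        ur' = of_real m1' * ul + of_real m2' * ul')"

definition transmission :: "SL_data \<Rightarrow> (real \<Rightarrow> complex) \<Rightarrow> bool" where
  "transmission P u \<longleftrightarrow>
     transmits P (theta_m P) (mu1 P) (mu2 P) (mu1' P) (mu2' P) u \<and>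
     transmits P (theta_p P) (eta1 P) (eta2 P) (eta1' P) (eta2' P) u"


section \<open>The Hilbert space\<close>

definition L2 :: "SL_data \<Rightarrow> (real \<Rightarrow> complex) set" where
  "L2 P = {f \<in> borel_measurable (lebesgue_on {a_pt P..b_pt P}).
             integrable (lebesgue_on {a_pt P..b_pt P}) (\<lambda>x. (cmod (f x))\<^sup>2)}"

definition ae_rel :: "SL_data \<Rightarrow> ((real \<Rightarrow> complex) \<times> (real \<Rightarrow> complex)) set" where
  "ae_rel P = {(f, g). f \<in> L2 P \<and> g \<in> L2 P \<and> (AE x in lebesgue_on {a_pt P..b_pt P}. f x = g x)}"

definition cls :: "SL_data \<Rightarrow> (real \<Rightarrow> complex) \<Rightarrow> (real \<Rightarrow> complex) set" where
  "cls P f = ae_rel P `` {f}"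

type_synonym hvec = "(real \<Rightarrow> complex) set \<times> complex"

definition H_space :: "SL_data \<Rightarrow> hvec set" where
  "H_space P = (L2 P // ae_rel P) \<times> UNIV"

definition rep :: "(real \<Rightarrow> complex) set \<Rightarrow> real \<Rightarrow> complex" where
  "rep c = (SOME f. f \<in> c)"

definition H_zero :: "SL_data \<Rightarrow> hvec" where
  "H_zero P = (cls P (\<lambda>x. 0), 0)"

definition H_scale :: "SL_data \<Rightarrow> complex \<Rightarrow> hvec \<Rightarrow> hvec" where
  "H_scale P l U = (cls P (\<lambda>x. l * rep (fst U) x), l * snd U)"

definition H_minus :: "SL_data \<Rightarrow> hvec \<Rightarrow> hvec \<Rightarrow> hvec" where
  "H_minus P U V = (cls P (\<lambda>x. rep (fst U) x - rep (fst V) x), snd U - snd V)"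

text \<open>The inner product completes the description of H; eigenvalues and the inverse of
  \<open>\<lambda>I - A\<close> only depend on the vector space structure.\<close>

definition H_inner :: "SL_data \<Rightarrow> hvec \<Rightarrow> hvec \<Rightarrow> complex" where
  "H_inner P F G =
     (LINT x|lebesgue_on (I1 P). rep (fst F) x * cnj (rep (fst G) x)) +
     of_real (1 / D1 P) * (LINT x|lebesgue_on (I2 P). rep (fst F) x * cnj (rep (fst G) x)) +
     of_real (1 / (D1 P * D2 P)) * (LINT x|lebesgue_on (I3 P). rep (fst F) x * cnj (rep (fst G) x)) +
     of_real (1 / (rho P * D1 P * D2 P)) * (snd F * cnj (snd G))"


section \<open>The operator\<close>

definition abs_cont_on :: "real set \<Rightarrow> (real \<Rightarrow> complex) \<Rightarrow> bool" where
  "abs_cont_on J g \<longleftrightarrow>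
     (\<forall>e>0. \<exists>d>0. \<forall>D. finite D \<longrightarrow> (\<forall>(s, t)\<in>D. s \<le> t \<and> {s..t} \<subseteq> J) \<longrightarrow>
        disjoint_family_on (\<lambda>(s, t). {s<..<t}) D \<longrightarrow> (\<Sum>(s, t)\<in>D. t - s) < d \<longrightarrow>
        (\<Sum>(s, t)\<in>D. cmod (g t - g s)) < e)"

definition piece_abs_cont :: "SL_data \<Rightarrow> real set \<Rightarrow> (real \<Rightarrow> complex) \<Rightarrow> bool" where
  "piece_abs_cont P J f \<longleftrightarrow> (\<exists>g. abs_cont_on J g \<and> (\<forall>x\<in>J \<inter> I_dom P. g x = f x))"

text \<open>First components of domain elements, represented by functions whose values at \<open>a\<close> and \<open>b\<close>
  are the one-sided limits. The almost everywhere differentiability of \<open>f'\<close> follows from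
  absolute continuity; it is spelled out because it is what makes \<open>\<tau>(f)\<close> defined almost
  everywhere.\<close>

definition dom_funs :: "SL_data \<Rightarrow> (real \<Rightarrow> complex) set" where
  "dom_funs P = {f \<in> L2 P.
     (\<forall>x\<in>I_dom P. f differentiable (at x within I_dom P)) \<and>
     (\<forall>J\<in>{I1 P, I2 P, I3 P}. piece_abs_cont P J f \<and> piece_abs_cont P J (der P f)) \<and>
     (AE x in lebesgue_on {a_pt P..b_pt P}. der P f differentiable (at x within I_dom P)) \<and>
     tau P f \<in> L2 P \<and>
     of_real (beta1 P) * f (a_pt P) + of_real (beta2 P) * der P f (a_pt P) = 0 \<and>
     transmission P f}"

definition dom_A :: "SL_data \<Rightarrow> hvec set" where
  "dom_A P = (\<lambda>f. (cls P f, R'_form P f)) ` dom_funs P"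

text \<open>Two functions in \<open>dom_funs\<close> with the same class agree on I, so the choice is immaterial.\<close>

definition dom_rep :: "SL_data \<Rightarrow> hvec \<Rightarrow> real \<Rightarrow> complex" where
  "dom_rep P U = (SOME f. f \<in> dom_funs P \<and> cls P f = fst U)"

definition op_A :: "SL_data \<Rightarrow> hvec \<Rightarrow> hvec" where
  "op_A P U = (cls P (tau P (dom_rep P U)), - R_form P (dom_rep P U))"

definition eigenvalue_A :: "SL_data \<Rightarrow> complex \<Rightarrow> bool" where
  "eigenvalue_A P lam \<longleftrightarrow> (\<exists>U\<in>dom_A P. U \<noteq> H_zero P \<and> op_A P U = H_scale P lam U)"

definition lam_minus_A :: "SL_data \<Rightarrow> complex \<Rightarrow> hvec \<Rightarrow> hvec" where
  "lam_minus_A P lam U = H_minus P (H_scale P lam U) (op_A P U)"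


section \<open>Solutions, characteristic function, Green's function\<close>

definition solves :: "SL_data \<Rightarrow> complex \<Rightarrow> (real \<Rightarrow> complex) \<Rightarrow> bool" where
  "solves P lam u \<longleftrightarrow>
     (\<forall>x\<in>I_dom P. u differentiable (at x within I_dom P) \<and>
        der P u differentiable (at x within I_dom P) \<and> tau P u x = lam * u x)"

definition is_phi :: "SL_data \<Rightarrow> complex \<Rightarrow> (real \<Rightarrow> complex) \<Rightarrow> bool" where
  "is_phi P lam u \<longleftrightarrow> solves P lam u \<and> transmission P u \<and>
     u (a_pt P) = of_real (beta2 P) \<and> der P u (a_pt P) = - of_real (beta1 P)"

definition is_chi :: "SL_data \<Rightarrow> complex \<Rightarrow> (real \<Rightarrow> complex) \<Rightarrow> bool" where
  "is_chi P lam u \<longleftrightarrow> solves P lam u \<and> transmission P u \<and>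
     u (b_pt P) = of_real (alpha2' P) * lam + of_real (alpha2 P) \<and>
     der P u (b_pt P) = of_real (alpha1' P) * lam + of_real (alpha1 P)"

text \<open>\<open>\<omega>(\<lambda>)\<close> is the constant value on the first piece of the Wronskian of \<open>\<phi>\<^sub>\<lambda>\<close> and \<open>\<chi>\<^sub>\<lambda>\<close>,
  read off at \<open>a\<close>.\<close>

definition omega :: "SL_data \<Rightarrow> (real \<Rightarrow> complex) \<Rightarrow> (real \<Rightarrow> complex) \<Rightarrow> complex" where
  "omega P phi chi = phi (a_pt P) * der P chi (a_pt P) - der P phi (a_pt P) * chi (a_pt P)"

definition green ::
  "SL_data \<Rightarrow> (real \<Rightarrow> complex) \<Rightarrow> (real \<Rightarrow> complex) \<Rightarrow> real \<Rightarrow> real \<Rightarrow> complex" where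
  "green P phi chi x y =
     (if y \<le> x then phi y * chi x / omega P phi chi else phi x * chi y / omega P phi chi)"

end

theory Submission
  imports Defs
begin

text \<open>Variation of parameters. With the weight \<open>w = 1, 1/D\<^sub>1, 1/(D\<^sub>1 D\<^sub>2)\<close> on the three pieces, \<open>w\<close> times
  the Wronskian of \<open>\<phi>\<^sub>\<lambda>\<close> and \<open>\<chi>\<^sub>\<lambda>\<close> is the constant \<open>\<omega>\<close>, so \<open>u = \<chi>A + \<phi>B\<close> with
  \<open>A = \<integral>\<^sub>a\<^sup>x w\<phi>f/\<omega>\<close> and \<open>B = \<integral>\<^sub>x\<^sup>b w\<chi>f/\<omega> + f\<^sub>1/(D\<^sub>1 D\<^sub>2 \<omega>)\<close> satisfies \<open>u' = \<chi>'A + \<phi>'B\<close> and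
  \<open>\<lambda>u - \<tau>(u) = f\<close> almost everywhere, the latter by Lebesgue's differentiation theorem. The first
  identity holds at every point although \<open>A\<close> and \<open>B\<close> are differentiable only almost everywhere, since the
  kernel \<open>\<chi>(x)\<phi>(t) - \<phi>(x)\<chi>(t)\<close> vanishes at \<open>t = x\<close>. Transmission conditions pass from \<open>\<phi>\<close> and \<open>\<chi>\<close>
  to \<open>u\<close> because \<open>A\<close> and \<open>B\<close> are continuous. If \<open>\<omega> = 0\<close>, then \<open>\<phi>\<close> satisfies the condition at \<open>b\<close>
  as well and \<open>\<lambda>\<close> is an eigenvalue.\<close>

section \<open>Differentiation of indefinite integrals\<close>

text \<open>The constant in \<open>B\<close> is forced by the condition at \<open>b\<close>. The
  data of \<open>\<chi>\<close> at \<open>b\<close> are the coefficients of the form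
  \<open>\<lambda>R' + R\<close>, so this form vanishes on \<open>\<chi>\<close>, while on
  \<open>\<phi>\<close> it is the Wronskian at \<open>b\<close>, that is
  \<open>D1 D2 \<omega>\<close>. On \<open>u\<close> it is therefore
  \<open>B(b) D1 D2 \<omega>\<close>, which has to be \<open>f1\<close>. At \<open>a\<close> the
  factor \<open>A\<close> vanishes and \<open>u\<close> inherits the condition of
  \<open>\<phi>\<close>. The domain of the operator asks for a first derivative at every point of
  \<open>I\<close>, but for a second one only almost everywhere, and \<open>f\<close> is merely
  square integrable. This is why the two derivatives are obtained by different means. Elements of
  \<open>H\<close> are classes and the operator works on a chosen representative. The choice is
  harmless because domain functions are continuous on \<open>I\<close> and so determined there by
  their class. Injectivity uses the absence of an eigenvalue once more: the difference of two
  preimages lies in the kernel.\<close>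

lemma integral_diff_eq:
  fixes g :: "real \<Rightarrow> 'a::euclidean_space"
  assumes g: "g integrable_on {a..b}" and "x \<in> {a..b}" "y \<in> {a..b}" "x \<le> y"
  shows "integral {a..y} g - integral {a..x} g = integral {x..y} g"
proof -
  have "integral {a..x} g + integral {x..y} g = integral {a..y} g"
  proof (rule Henstock_Kurzweil_Integration.integral_combine)
    show "g integrable_on {a..y}"
      using assms by (intro integrable_subinterval_real[OF g]) simp
  qed (use assms in auto)
  then show ?thesis by (simp add: algebra_simps)
qed

lemma has_vector_derivative_iff_quotient:
  fixes f :: "real \<Rightarrow> 'a::real_normed_vector"
  shows "(f has_vector_derivative D) (at x within S) \<longleftrightarrow>
         ((\<lambda>y. (f y - f x) /\<^sub>R (y - x)) \<longlongrightarrow> D) (at x within S)"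
proof -
  have "(f has_vector_derivative D) (at x within S) \<longleftrightarrow>
        ((\<lambda>y. norm ((1 / norm (y - x)) *\<^sub>R (f y - (f x + (y - x) *\<^sub>R D)))) \<longlongrightarrow> 0) (at x within S)"
    by (subst tendsto_norm_zero_iff)
      (simp add: has_vector_derivative_def has_derivative_within bounded_linear_scaleR_left)
  also have "\<dots> \<longleftrightarrow> ((\<lambda>y. norm ((f y - f x) /\<^sub>R (y - x) - D)) \<longlongrightarrow> 0) (at x within S)"
  proof (rule filterlim_cong[OF refl refl])
    have "norm ((1 / norm (y - x)) *\<^sub>R (f y - (f x + (y - x) *\<^sub>R D))) = norm ((f y - f x) /\<^sub>R (y - x) - D)"
      if "y \<noteq> x" for y
    proof -
      have "(f y - f x) /\<^sub>R (y - x) - D = inverse (y - x) *\<^sub>R (f y - (f x + (y - x) *\<^sub>R D))"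
        using that by (simp add: scaleR_diff_right diff_diff_eq[symmetric])
      then show ?thesis
        by (simp add: divide_inverse)
    qed
    then show "\<forall>\<^sub>F y in at x within S. norm ((1 / norm (y - x)) *\<^sub>R (f y - (f x + (y - x) *\<^sub>R D)))
        = norm ((f y - f x) /\<^sub>R (y - x) - D)"
      by (simp add: eventually_at_filter)
  qed
  also have "\<dots> \<longleftrightarrow> ((\<lambda>y. (f y - f x) /\<^sub>R (y - x)) \<longlongrightarrow> D) (at x within S)"
    by (simp add: tendsto_norm_zero_iff LIM_zero_iff)
  finally show ?thesis .
qed

text \<open>Vitali covering by the intervals on which the difference quotient is bad; Henstock's lemma
  bounds the total length of any finite disjoint family of them.\<close>

lemma negligible_not_approximated:
  fixes F :: "real \<Rightarrow> 'a::euclidean_space"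
  assumes F: "F integrable_on {a..b}" and "k > 0"
  defines "bad \<equiv> \<lambda>s t x. a < s \<and> s < t \<and> t < b \<and> x \<in> {s, t} \<and>
            k * (t - s) \<le> norm (measure lborel {s..t} *\<^sub>R F x - integral {s..t} F)"
  shows "negligible {x. \<forall>d>0. \<exists>s t. bad s t x \<and> t - s < d}"
  unfolding negligible_outer_le
proof (intro allI impI)
  fix e :: real assume "e > 0"
  define E where "E = {x. \<forall>d>0. \<exists>s t. bad s t x \<and> t - s < d}"
  \<comment> \<open>Each bad interval contributes at least \<open>k\<close> times its length to the
    Henstock sum, so the bound \<open>k * e\<close> leaves total length at most
    \<open>e\<close>.\<close>
  have "0 < k * e" using \<open>k > 0\<close> \<open>e > 0\<close> by simp
  then obtain \<gamma> where "gauge \<gamma>"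
    and \<gamma>: "\<And>p. \<lbrakk>p tagged_partial_division_of cbox a b; \<gamma> fine p\<rbrakk> \<Longrightarrow>
              (\<Sum>(x, K)\<in>p. norm (measure lborel K *\<^sub>R F x - integral K F)) < k * e"
    using Henstock_lemma[of F a b "k * e"] F by auto
  define K where "K = {(s, t, x). bad s t x \<and> {s..t} \<subseteq> \<gamma> x}"
  define ctr :: "real \<times> real \<times> real \<Rightarrow> real" where "ctr = (\<lambda>(s, t, x). (s + t) / 2)"
  define rad :: "real \<times> real \<times> real \<Rightarrow> real" where "rad = (\<lambda>(s, t, x). (t - s) / 2)"
  define iv :: "real \<times> real \<times> real \<Rightarrow> real set" where "iv = (\<lambda>(s, t, x). {s..t})"
  define tg :: "real \<times> real \<times> real \<Rightarrow> real" where "tg = (\<lambda>(s, t, x). x)"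
  have cball: "cball (ctr i) (rad i) = iv i" for i
  proof (cases i)
    case (fields s t x)
    then show ?thesis
      by (auto simp: ctr_def rad_def iv_def cball_eq_atLeastAtMost field_simps)
  qed
  have rad_pos: "0 < rad i" if "i \<in> K" for i
    using that by (auto simp: K_def bad_def rad_def)
  obtain C where "countable C" "C \<subseteq> K"
    and pw: "pairwise (\<lambda>i j. disjnt (cball (ctr i) (rad i)) (cball (ctr j) (rad j))) C"
    and neg: "negligible (E - (\<Union>i\<in>C. cball (ctr i) (rad i)))"
  proof (rule Vitali_covering_theorem_cballs[of K rad E ctr])
    fix x d :: real assume "x \<in> E" "0 < d"
    from \<open>gauge \<gamma>\<close> obtain r where "r > 0" and r: "ball x r \<subseteq> \<gamma> x"
      by (meson gauge_def open_contains_ball)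
    have "\<forall>d>0. \<exists>s t. bad s t x \<and> t - s < d"
      using \<open>x \<in> E\<close> by (simp add: E_def)
    moreover have "min d r > 0"
      using \<open>0 < d\<close> \<open>r > 0\<close> by simp
    ultimately obtain s t where "bad s t x" "t - s < min d r"
      by blast
    \<comment> \<open>A bad interval has \<open>x\<close> as an end point, so being shorter than
      \<open>r\<close> is enough for fineness.\<close>
    then have "{s..t} \<subseteq> ball x r"
      by (auto simp: bad_def dist_real_def)
    with r \<open>bad s t x\<close> have "(s, t, x) \<in> K"
      by (auto simp: K_def)
    moreover have "x \<in> iv (s, t, x)" "rad (s, t, x) < d"
      using \<open>bad s t x\<close> \<open>t - s < min d r\<close> by (auto simp: bad_def iv_def rad_def)
    ultimately show "\<exists>i. i \<in> K \<and> x \<in> cball (ctr i) (rad i) \<and> rad i < d"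
      using cball by blast
  qed (use rad_pos in auto)
  have disj: "iv i \<inter> iv j = {}" if "i \<in> C" "j \<in> C" "i \<noteq> j" for i j
    using pw that unfolding cball by (auto simp: pairwise_def disjnt_def)
  have finite_sum: "(\<Sum>i\<in>C'. measure lebesgue (iv i)) \<le> e" if "finite C'" "C' \<subseteq> C" for C'
  proof -
    have in_K: "i \<in> K" if "i \<in> C'" for i
      using that \<open>C' \<subseteq> C\<close> \<open>C \<subseteq> K\<close> by auto
    have iv_ne: "iv i \<noteq> {}" and tg_iv: "tg i \<in> iv i" if "i \<in> C'" for i
      using in_K[OF that] by (auto simp: K_def bad_def iv_def tg_def)
    \<comment> \<open>Distinct members of \<open>C\<close> have disjoint nonempty intervals, so
      passing to the set \<open>p\<close> merges no two summands.\<close>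
    have inj: "inj_on (\<lambda>i. (tg i, iv i)) C'"
      using disj iv_ne \<open>C' \<subseteq> C\<close> by (fastforce simp: inj_on_def)
    define p where "p = (\<lambda>i. (tg i, iv i)) ` C'"
    have "p tagged_partial_division_of cbox a b"
      unfolding tagged_partial_division_of_def
    proof (intro conjI allI impI)
      show "finite p" using \<open>finite C'\<close> by (simp add: p_def)
    next
      fix x J assume "(x, J) \<in> p"
      then obtain i where i: "i \<in> C'" "x = tg i" "J = iv i" by (auto simp: p_def)
      then show "x \<in> J" using tg_iv by simp
      show "J \<subseteq> cbox a b" using in_K[OF i(1)] i by (auto simp: K_def bad_def iv_def)
      show "\<exists>u v. J = cbox u v" using i by (cases i) (auto simp: iv_def)
    next
      fix x1 J1 x2 J2 assume *: "(x1, J1) \<in> p \<and> (x2, J2) \<in> p \<and> (x1, J1) \<noteq> (x2, J2)"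
      then obtain i j where "i \<in> C'" "j \<in> C'" "(x1, J1) = (tg i, iv i)" "(x2, J2) = (tg j, iv j)"
        unfolding p_def by blast
      with * disj \<open>C' \<subseteq> C\<close> have "J1 \<inter> J2 = {}" by blast
      then show "interior J1 \<inter> interior J2 = {}"
        using interior_subset by blast
    qed
    moreover have "\<gamma> fine p"
      using in_K by (fastforce simp: fine_def p_def K_def iv_def tg_def)
    ultimately have *: "(\<Sum>(x, K)\<in>p. norm (measure lborel K *\<^sub>R F x - integral K F)) < k * e"
      by (rule \<gamma>)
    have "k * (\<Sum>i\<in>C'. measure lebesgue (iv i)) \<le>
          (\<Sum>i\<in>C'. norm (measure lborel (iv i) *\<^sub>R F (tg i) - integral (iv i) F))"
      unfolding sum_distrib_left
    proof (rule sum_mono)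
      fix i assume "i \<in> C'"
      then show "k * measure lebesgue (iv i) \<le> norm (measure lborel (iv i) *\<^sub>R F (tg i) - integral (iv i) F)"
        using in_K by (cases i) (fastforce simp: K_def bad_def iv_def tg_def)
    qed
    also have "\<dots> = (\<Sum>(x, K)\<in>p. norm (measure lborel K *\<^sub>R F x - integral K F))"
      unfolding p_def by (subst sum.reindex[OF inj]) simp
    also have "\<dots> < k * e" by (rule *)
    finally show ?thesis
      using \<open>k > 0\<close> by simp
  qed
  have iv_meas: "iv i \<in> lmeasurable" for i
    by (cases i) (auto simp: iv_def)
  have U: "(\<Union>i\<in>C. iv i) \<in> lmeasurable" "measure lebesgue (\<Union>i\<in>C. iv i) \<le> e"
  proof -
    have le: "measure lebesgue (\<Union>i\<in>C'. iv i) \<le> e" if "C' \<subseteq> C" "finite C'" for C'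
    proof -
      have "measure lebesgue (\<Union>i\<in>C'. iv i) \<le> (\<Sum>i\<in>C'. measure lebesgue (iv i))"
        using iv_meas by (intro measure_UNION_le \<open>finite C'\<close>) (simp add: fmeasurableD)
      with finite_sum[OF \<open>finite C'\<close> \<open>C' \<subseteq> C\<close>] show ?thesis by linarith
    qed
    show "(\<Union>i\<in>C. iv i) \<in> lmeasurable"
      by (rule fmeasurable_UN_bound[OF \<open>countable C\<close> iv_meas le])
    show "measure lebesgue (\<Union>i\<in>C. iv i) \<le> e"
      by (rule measure_UN_bound[OF \<open>countable C\<close> iv_meas le])
  qed
  let ?N = "E - (\<Union>i\<in>C. iv i)"
  have N: "negligible ?N" using neg unfolding cball .
  show "\<exists>T. {x. \<forall>d>0. \<exists>s t. bad s t x \<and> t - s < d} \<subseteq> T \<and> T \<in> lmeasurable \<and> measure lebesgue T \<le> e"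
  proof (intro exI conjI)
    show "{x. \<forall>d>0. \<exists>s t. bad s t x \<and> t - s < d} \<subseteq> ?N \<union> (\<Union>i\<in>C. iv i)"
      unfolding E_def by auto
    show "?N \<union> (\<Union>i\<in>C. iv i) \<in> lmeasurable"
      using negligible_imp_measurable[OF N] U(1) by (rule fmeasurable.Un)
    have "measure lebesgue (?N \<union> (\<Union>i\<in>C. iv i)) \<le> measure lebesgue ?N + measure lebesgue (\<Union>i\<in>C. iv i)"
      by (rule measure_Un_le[OF negligible_imp_sets[OF N] fmeasurableD[OF U(1)]])
    then show "measure lebesgue (?N \<union> (\<Union>i\<in>C. iv i)) \<le> e"
      using U(2) negligible_imp_measure0[OF N] by linarith
  qed
qed

text \<open>If the difference quotients at \<open>x\<close> do not converge to \<open>F x\<close>,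
  they miss it by some \<open>1 / (n + 1)\<close> on arbitrarily short intervals ending at
  \<open>x\<close>. The exceptional set is thus covered by countably many null sets.\<close>

theorem negligible_not_has_vector_derivative_integral:
  fixes F :: "real \<Rightarrow> 'a::euclidean_space"
  assumes F: "F integrable_on {a..b}"
  shows "negligible {x \<in> {a<..<b}. \<not> ((\<lambda>y. integral {a..y} F) has_vector_derivative F x) (at x)}"
proof -
  define bad where "bad = (\<lambda>k s t x. a < s \<and> s < t \<and> t < b \<and> x \<in> {s, t} \<and>
            k * (t - s) \<le> norm (measure lborel {s..t} *\<^sub>R F x - integral {s..t} F))"
  define E where "E = (\<lambda>k. {x. \<forall>d>0. \<exists>s t. bad k s t x \<and> t - s < d})"
  have "negligible (E (1 / real (Suc n)))" for n
    unfolding E_def bad_def by (rule negligible_not_approximated[OF F]) simp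
  then have "negligible (\<Union>n. E (1 / real (Suc n)))"
    by (rule negligible_Union_nat)
  moreover have "{x \<in> {a<..<b}. \<not> ((\<lambda>y. integral {a..y} F) has_vector_derivative F x) (at x)} \<subseteq>
    (\<Union>n. E (1 / real (Suc n)))"
  proof clarify
    fix x assume x: "x \<in> {a<..<b}" and nd: "\<not> ((\<lambda>y. integral {a..y} F) has_vector_derivative F x) (at x)"
    show "x \<in> (\<Union>n. E (1 / real (Suc n)))"
    proof (rule ccontr)
      assume x_notin: "x \<notin> (\<Union>n. E (1 / real (Suc n)))"
      have "((\<lambda>y. integral {a..y} F) has_vector_derivative F x) (at x)"
        unfolding has_vector_derivative_iff_quotient tendsto_iff
      proof (intro allI impI)
        fix e :: real assume "e > 0"
        then obtain n where n: "1 / real (Suc n) < e"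
          using nat_approx_posE by blast
        have "x \<notin> E (1 / real (Suc n))"
          using x_notin by blast
        then obtain d where "d > 0" and d: "\<And>s t. bad (1 / real (Suc n)) s t x \<Longrightarrow> \<not> t - s < d"
          unfolding E_def mem_Collect_eq by blast
        have "dist ((integral {a..y} F - integral {a..x} F) /\<^sub>R (y - x)) (F x) < e"
          if y: "y \<noteq> x" "dist y x < min d (min (x - a) (b - x))" for y
        proof -
          \<comment> \<open>Sorting \<open>x\<close> and \<open>y\<close> treats both sides at once,
            since \<open>bad\<close> allows \<open>x\<close> at either end.\<close>
          define s t where "s = min x y" and "t = max x y"
          have st: "a < s" "s < t" "t < b" "x \<in> {s, t}" "t - s < d"
            using x y unfolding s_def t_def dist_real_def
            by (cases "x < y"; simp add: abs_if)+
          then have "\<not> bad (1 / real (Suc n)) s t x" using d by blast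
          then have *: "norm ((t - s) *\<^sub>R F x - integral {s..t} F) < 1 / real (Suc n) * (t - s)"
            using st by (auto simp: bad_def not_le)
          have eq: "integral {s..t} F = integral {a..t} F - integral {a..s} F"
            using st by (intro integral_diff_eq[OF F, symmetric]) auto
          have "(integral {a..y} F - integral {a..x} F) /\<^sub>R (y - x) = integral {s..t} F /\<^sub>R (t - s)"
          proof (cases "x < y")
            case True
            then show ?thesis using eq by (simp add: s_def t_def)
          next
            case False
            then have "(integral {a..y} F - integral {a..x} F) /\<^sub>R (y - x) =
                (- (integral {a..x} F - integral {a..y} F)) /\<^sub>R (- (x - y))"
              by simp
            also have "\<dots> = (integral {a..x} F - integral {a..y} F) /\<^sub>R (x - y)"
              by (simp del: minus_diff_eq)
            finally show ?thesis using False eq by (simp add: s_def t_def)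
          qed
          moreover have "integral {s..t} F /\<^sub>R (t - s) - F x =
              - (((t - s) *\<^sub>R F x - integral {s..t} F) /\<^sub>R (t - s))"
            using st by (simp add: scaleR_diff_right)
          ultimately have "dist ((integral {a..y} F - integral {a..x} F) /\<^sub>R (y - x)) (F x) =
              norm ((t - s) *\<^sub>R F x - integral {s..t} F) / (t - s)"
            using st by (simp add: dist_norm divide_inverse_commute)
          also have "\<dots> < 1 / real (Suc n)"
            using * st by (simp add: pos_divide_less_eq)
          finally show ?thesis using n by linarith
        qed
        then show "\<forall>\<^sub>F y in at x. dist ((integral {a..y} F - integral {a..x} F) /\<^sub>R (y - x)) (F x) < e"
          unfolding eventually_at using \<open>d > 0\<close> x
          by (intro exI[of _ "min d (min (x - a) (b - x))"]) auto
      qed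
      with nd show False by simp
    qed
  qed
  ultimately show ?thesis
    by (rule negligible_subset)
qed

text \<open>A product rule in which \<open>A\<close> is only continuous at \<open>x\<close>: as
  \<open>g x = 0\<close>, the difference quotient of the product is that of \<open>g\<close> times
  \<open>A y\<close>.\<close>

lemma has_vector_derivative_mult_vanishing:
  fixes g A :: "real \<Rightarrow> 'a::real_normed_field"
  assumes g: "(g has_vector_derivative D) (at x within S)" and "g x = 0"
    and A: "(A \<longlongrightarrow> A x) (at x within S)"
  shows "((\<lambda>y. g y * A y) has_vector_derivative D * A x) (at x within S)"
proof -
  have "((\<lambda>y. (g y - g x) /\<^sub>R (y - x) * A y) \<longlongrightarrow> D * A x) (at x within S)"
    by (intro tendsto_mult A) (use g in \<open>simp add: has_vector_derivative_iff_quotient\<close>)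
  then show ?thesis
    by (simp add: has_vector_derivative_iff_quotient \<open>g x = 0\<close>)
qed

text \<open>Near \<open>x\<close> the kernel is at most \<open>M * \<bar>t - x\<bar>\<close>, which
  absorbs the division by \<open>y - x\<close>. What remains is \<open>M\<close> times the integral
  of \<open>cmod (F t)\<close> between \<open>x\<close> and \<open>y\<close>; it tends to 0 even if
  \<open>F\<close> is unbounded.\<close>

lemma has_vector_derivative_integral_vanishing:
  fixes k F :: "real \<Rightarrow> complex"
  assumes x: "x \<in> {a..b}" and F: "F absolutely_integrable_on {a..b}"
    and kF: "(\<lambda>t. k t * F t) integrable_on {a..b}"
    and k: "(k has_vector_derivative k') (at x within {a..b})" "k x = 0"
  shows "((\<lambda>y. integral {a..y} (\<lambda>t. k t * F t)) has_vector_derivative 0) (at x within {a..b})"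
proof -
  \<comment> \<open>The summand 1 puts \<open>M\<close> strictly above the limit of the norms of the
    quotients of \<open>k\<close>, hence above these norms near \<open>x\<close>.\<close>
  define M where "M = cmod k' + 1"
  define H where "H = (\<lambda>y. integral {a..y} (\<lambda>t. k t * F t))"
  define N where "N = (\<lambda>y. integral {a..y} (\<lambda>t. cmod (F t)))"
  have F': "(\<lambda>t. cmod (F t)) integrable_on {a..b}"
    using F by (simp add: absolutely_integrable_on_def)
  have "((\<lambda>y. cmod ((k y - k x) /\<^sub>R (y - x))) \<longlongrightarrow> cmod k') (at x within {a..b})"
    using k by (intro tendsto_norm) (simp add: has_vector_derivative_iff_quotient)
  then have "\<forall>\<^sub>F y in at x within {a..b}. cmod ((k y - k x) /\<^sub>R (y - x)) < M"
    by (rule order_tendstoD) (simp add: M_def)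
  then obtain d where "d > 0"
    and d: "\<And>y. y \<in> {a..b} \<Longrightarrow> y \<noteq> x \<Longrightarrow> dist y x < d \<Longrightarrow> cmod ((k y - k x) /\<^sub>R (y - x)) < M"
    unfolding eventually_at by blast
  have kM: "cmod (k t) \<le> M * \<bar>t - x\<bar>" if "t \<in> {a..b}" "dist t x < d" for t
  proof (cases "t = x")
    case False
    then have "cmod (k t) / \<bar>t - x\<bar> < M"
      using d[OF that(1) False that(2)] k(2) by (simp add: divide_inverse_commute)
    then show ?thesis using False by (simp add: pos_divide_less_eq)
  qed (simp add: k)
  have st: "cmod (integral {s..t} (\<lambda>t. k t * F t)) \<le> M * (t - s) * integral {s..t} (\<lambda>t. cmod (F t))"
    if st: "a \<le> s" "s \<le> t" "t \<le> b" "x \<in> {s, t}" "t - s < d" for s t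
  proof -
    have "cmod (integral {s..t} (\<lambda>t. k t * F t)) \<le> integral {s..t} (\<lambda>r. M * (t - s) * cmod (F r))"
    proof (rule integral_norm_bound_integral)
      show "(\<lambda>t. k t * F t) integrable_on {s..t}"
        using st by (intro integrable_subinterval_real[OF kF]) auto
      show "(\<lambda>r. M * (t - s) * cmod (F r)) integrable_on {s..t}"
        using st by (intro integrable_on_mult_right integrable_subinterval_real[OF F']) auto
      fix r assume r: "r \<in> {s..t}"
      have "dist r x < d" "\<bar>r - x\<bar> \<le> t - s" using r st by (auto simp: dist_real_def)
      moreover have "r \<in> {a..b}" using r st by auto
      ultimately have "cmod (k r) \<le> M * (t - s)"
        using kM[of r] by (smt (verit) M_def mult_left_mono norm_ge_zero)
      then show "cmod (k r * F r) \<le> M * (t - s) * cmod (F r)"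
        by (simp add: norm_mult mult_right_mono)
    qed
    then show ?thesis by simp
  qed
  have bound: "cmod ((H y - H x) /\<^sub>R (y - x)) \<le> M * \<bar>N y - N x\<bar>"
    if y: "y \<in> {a..b}" "y \<noteq> x" "dist y x < d" for y
  proof -
    have "cmod (H y - H x) \<le> M * \<bar>y - x\<bar> * \<bar>N y - N x\<bar>"
    proof (cases "x < y")
      case True
      have "H y - H x = integral {x..y} (\<lambda>t. k t * F t)" "N y - N x = integral {x..y} (\<lambda>t. cmod (F t))"
        unfolding H_def N_def using x y True integral_diff_eq[OF kF x y(1)] integral_diff_eq[OF F' x y(1)]
        by auto
      moreover have "integral {x..y} (\<lambda>t. cmod (F t)) \<ge> 0"
        using x y True by (intro integral_nonneg integrable_subinterval_real[OF F']) auto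
      ultimately show ?thesis using st[of x y] x y True by (simp add: dist_real_def)
    next
      case False
      have "H x - H y = integral {y..x} (\<lambda>t. k t * F t)" "N x - N y = integral {y..x} (\<lambda>t. cmod (F t))"
        unfolding H_def N_def using x y False integral_diff_eq[OF kF y(1) x] integral_diff_eq[OF F' y(1) x]
        by auto
      moreover have "integral {y..x} (\<lambda>t. cmod (F t)) \<ge> 0"
        using x y False by (intro integral_nonneg integrable_subinterval_real[OF F']) auto
      ultimately show ?thesis using st[of y x] x y False
        by (simp add: dist_real_def norm_minus_commute[of "H y"] abs_minus_commute[of "N y"] abs_minus_commute[of y])
    qed
    then show ?thesis using y(2) by (simp add: pos_divide_le_eq divide_inverse_commute[symmetric] mult_ac)
  qed
  have "continuous_on {a..b} N"
    unfolding N_def by (rule indefinite_integral_continuous_1[OF F'])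
  then have "(N \<longlongrightarrow> N x) (at x within {a..b})"
    using x by (simp add: continuous_on_def)
  then have "((\<lambda>y. M * \<bar>N y - N x\<bar>) \<longlongrightarrow> M * \<bar>N x - N x\<bar>) (at x within {a..b})"
    by (intro tendsto_intros)
  then have "((\<lambda>y. M * \<bar>N y - N x\<bar>) \<longlongrightarrow> 0) (at x within {a..b})"
    by simp
  moreover have "\<forall>\<^sub>F y in at x within {a..b}. cmod ((H y - H x) /\<^sub>R (y - x)) \<le> M * \<bar>N y - N x\<bar>"
    unfolding eventually_at using \<open>d > 0\<close> bound by blast
  ultimately have "(H has_vector_derivative 0) (at x within {a..b})"
    unfolding has_vector_derivative_iff_quotient by (rule Lim_null_comparison[rotated])
  then show ?thesis by (simp add: H_def)
qed

section \<open>Absolute continuity\<close>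

text \<open>End points are negligible and the open intervals are disjoint, so the sum is a single
  integral over their union.\<close>

lemma sum_integral_disjoint_le:
  fixes G :: "real \<Rightarrow> real"
  assumes G: "G integrable_on {a..b}" and pos: "\<And>x. x \<in> {a..b} \<Longrightarrow> 0 \<le> G x"
    and D: "finite D" "\<And>s t. (s, t) \<in> D \<Longrightarrow> s \<le> t \<and> {s..t} \<subseteq> {a..b}"
    and disj: "disjoint_family_on (\<lambda>(s, t). {s<..<t}) D"
  shows "(\<Sum>(s, t)\<in>D. integral {s..t} G) \<le> integral {a..b} G"
proof -
  let ?T = "\<lambda>(s, t). {s<..<t :: real}"
  have I: "(G has_integral (\<Sum>(s, t)\<in>D. integral {s..t} G)) (\<Union>i\<in>D. ?T i)"
  proof (rule has_integral_UN[OF D(1)])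
    fix i assume "i \<in> D"
    obtain s t where i: "i = (s, t)" by (cases i)
    have "G integrable_on {s..t}"
      using D(2) \<open>i \<in> D\<close> i by (blast intro: integrable_subinterval_real[OF G])
    then show "(G has_integral (case i of (s, t) \<Rightarrow> integral {s..t} G)) (?T i)"
      unfolding i by (simp add: has_integral_Icc_iff_Ioo[symmetric] integrable_integral)
  next
    show "pairwise (\<lambda>i i'. negligible (?T i \<inter> ?T i')) D"
      using disj by (simp add: pairwise_def disjoint_family_on_def)
  qed
  have "(\<Union>i\<in>D. ?T i) \<subseteq> {a..b}"
    using D(2) by fastforce
  then have "integral (\<Union>i\<in>D. ?T i) G \<le> integral {a..b} G"
    using I G pos by (intro integral_subset_le) (auto simp: has_integral_integrable)
  then show ?thesis using I by (simp add: integral_unique)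
qed

text \<open>The bound \<open>\<parallel>F\<parallel> \<le> K + \<parallel>F\<parallel>\<^sup>2 / K\<close> makes the part of the increments that does not shrink with
  the intervals small uniformly, by the choice of \<open>K\<close>.\<close>

lemma abs_cont_on_integral:
  fixes F :: "real \<Rightarrow> complex"
  assumes F: "F integrable_on {a..b}" and F2: "(\<lambda>x. (cmod (F x))\<^sup>2) integrable_on {a..b}"
  shows "abs_cont_on {a..b} (\<lambda>x. integral {a..x} F)"
  unfolding abs_cont_on_def
proof (intro allI impI)
  fix e :: real assume "e > 0"
  define Q where "Q = integral {a..b} (\<lambda>x. (cmod (F x))\<^sup>2)"
  \<comment> \<open>This gives \<open>Q / K < e / 2\<close>, and the next line gives
    \<open>K * d = e / 2\<close>. The summand 1 keeps \<open>K\<close> positive when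
    \<open>Q = 0\<close>.\<close>
  define K where "K = 2 * (Q + 1) / e"
  define d where "d = e / (2 * K)"
  have "Q \<ge> 0" unfolding Q_def by (rule integral_nonneg[OF F2]) simp
  then have "K > 0" using \<open>e > 0\<close> by (simp add: K_def)
  then have "d > 0" using \<open>e > 0\<close> by (simp add: d_def)
  have QK: "Q / K < e / 2" using \<open>Q \<ge> 0\<close> \<open>e > 0\<close> by (simp add: K_def field_simps)
  show "\<exists>d>0. \<forall>D. finite D \<longrightarrow> (\<forall>(s, t)\<in>D. s \<le> t \<and> {s..t} \<subseteq> {a..b}) \<longrightarrow>
      disjoint_family_on (\<lambda>(s, t). {s<..<t}) D \<longrightarrow> (\<Sum>(s, t)\<in>D. t - s) < d \<longrightarrow>
      (\<Sum>(s, t)\<in>D. cmod (integral {a..t} F - integral {a..s} F)) < e"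
  proof (intro exI[of _ d] conjI allI impI \<open>d > 0\<close>)
    fix D :: "(real \<times> real) set"
    assume D: "finite D" "\<forall>(s, t)\<in>D. s \<le> t \<and> {s..t} \<subseteq> {a..b}"
      and disj: "disjoint_family_on (\<lambda>(s, t). {s<..<t}) D" and len: "(\<Sum>(s, t)\<in>D. t - s) < d"
    let ?N = "\<lambda>x. (cmod (F x))\<^sup>2"
    have step: "cmod (integral {a..t} F - integral {a..s} F) \<le> K * (t - s) + integral {s..t} ?N / K"
      if "(s, t) \<in> D" for s t
    proof -
      have st: "s \<le> t" "{s..t} \<subseteq> {a..b}" using D that by auto
      then have ab: "a \<le> s" "t \<le> b" by auto
      have "integral {a..t} F - integral {a..s} F = integral {s..t} F"
        using ab st(1) by (intro integral_diff_eq[OF F]) auto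
      also have "cmod \<dots> \<le> integral {s..t} (\<lambda>x. K + ?N x / K)"
      proof (rule integral_norm_bound_integral)
        show "F integrable_on {s..t}" using st by (blast intro: integrable_subinterval_real[OF F])
        show "(\<lambda>x. K + ?N x / K) integrable_on {s..t}"
          by (intro integrable_add integrable_on_divide integrable_subinterval_real[OF F2] st
              integrable_const_ivl)
        fix x
        have "0 \<le> cmod (F x) * K"
          using \<open>K > 0\<close> by simp
        then have "cmod (F x) * K \<le> K\<^sup>2 + ?N x"
          using sum_squares_bound[of "cmod (F x)" K] by linarith
        then show "cmod (F x) \<le> K + ?N x / K"
          using \<open>K > 0\<close> by (simp add: field_simps power2_eq_square)
      qed
      also have "\<dots> = K * (t - s) + integral {s..t} ?N / K"
        using st(1) integrable_on_divide[OF integrable_subinterval_real[OF F2 st(2)]]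
        by (subst integral_add) auto
      finally show ?thesis .
    qed
    have "(\<Sum>(s, t)\<in>D. cmod (integral {a..t} F - integral {a..s} F)) \<le>
        (\<Sum>(s, t)\<in>D. K * (t - s) + integral {s..t} ?N / K)"
      using step by (intro sum_mono) auto
    also have "\<dots> = K * (\<Sum>(s, t)\<in>D. t - s) + (\<Sum>(s, t)\<in>D. integral {s..t} ?N) / K"
      by (simp add: case_prod_unfold sum.distrib sum_distrib_left sum_divide_distrib)
    also have "\<dots> \<le> K * d + Q / K"
    proof (rule add_mono)
      show "K * (\<Sum>(s, t)\<in>D. t - s) \<le> K * d" using len \<open>K > 0\<close> by simp
      have "(\<Sum>(s, t)\<in>D. integral {s..t} ?N) \<le> Q"
        unfolding Q_def by (rule sum_integral_disjoint_le[OF F2 _ D(1) _ disj]) (use D(2) in auto)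
      then show "(\<Sum>(s, t)\<in>D. integral {s..t} ?N) / K \<le> Q / K"
        using \<open>K > 0\<close> by (simp add: divide_right_mono)
    qed
    also have "\<dots> < e"
    proof -
      have "K * d = e / 2" using \<open>K > 0\<close> by (simp add: d_def)
      then show ?thesis using QK by linarith
    qed
    finally show "(\<Sum>(s, t)\<in>D. cmod (integral {a..t} F - integral {a..s} F)) < e" .
  qed
qed

text \<open>One comparison of increments from which Lipschitz functions, sums, differences and
  products are all handled by a choice of \<open>g\<close>, \<open>h\<close> and
  \<open>M\<close>.\<close>

lemma abs_cont_on_dominated:
  assumes g: "abs_cont_on J g" and h: "abs_cont_on J h" and "M \<ge> 0"
    and le: "\<And>s t. s \<le> t \<Longrightarrow> {s..t} \<subseteq> J \<Longrightarrow> cmod (k t - k s) \<le> M * (cmod (g t - g s) + cmod (h t - h s))"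
  shows "abs_cont_on J k"
  unfolding abs_cont_on_def
proof (intro allI impI)
  fix e :: real assume "e > 0"
  \<comment> \<open>Dividing by \<open>M + 1\<close> admits \<open>M = 0\<close> and keeps the final
    inequality strict.\<close>
  define e' where "e' = (e / (M + 1)) / 2"
  have "e' > 0" using \<open>e > 0\<close> \<open>M \<ge> 0\<close> by (simp add: e'_def)
  obtain d1 where "d1 > 0" and d1: "\<And>D. finite D \<Longrightarrow> \<forall>(s, t)\<in>D. s \<le> t \<and> {s..t} \<subseteq> J \<Longrightarrow>
      disjoint_family_on (\<lambda>(s, t). {s<..<t}) D \<Longrightarrow> (\<Sum>(s, t)\<in>D. t - s) < d1 \<Longrightarrow>
      (\<Sum>(s, t)\<in>D. cmod (g t - g s)) < e'"
    using g \<open>e' > 0\<close> unfolding abs_cont_on_def by blast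
  obtain d2 where "d2 > 0" and d2: "\<And>D. finite D \<Longrightarrow> \<forall>(s, t)\<in>D. s \<le> t \<and> {s..t} \<subseteq> J \<Longrightarrow>
      disjoint_family_on (\<lambda>(s, t). {s<..<t}) D \<Longrightarrow> (\<Sum>(s, t)\<in>D. t - s) < d2 \<Longrightarrow>
      (\<Sum>(s, t)\<in>D. cmod (h t - h s)) < e'"
    using h \<open>e' > 0\<close> unfolding abs_cont_on_def by blast
  show "\<exists>d>0. \<forall>D. finite D \<longrightarrow> (\<forall>(s, t)\<in>D. s \<le> t \<and> {s..t} \<subseteq> J) \<longrightarrow>
      disjoint_family_on (\<lambda>(s, t). {s<..<t}) D \<longrightarrow> (\<Sum>(s, t)\<in>D. t - s) < d \<longrightarrow>
      (\<Sum>(s, t)\<in>D. cmod (k t - k s)) < e"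
  proof (intro exI[of _ "min d1 d2"] conjI allI impI)
    show "min d1 d2 > 0" using \<open>d1 > 0\<close> \<open>d2 > 0\<close> by simp
    fix D :: "(real \<times> real) set"
    assume D: "finite D" "\<forall>(s, t)\<in>D. s \<le> t \<and> {s..t} \<subseteq> J"
      and disj: "disjoint_family_on (\<lambda>(s, t). {s<..<t}) D" and len: "(\<Sum>(s, t)\<in>D. t - s) < min d1 d2"
    have "(\<Sum>(s, t)\<in>D. cmod (k t - k s)) \<le> (\<Sum>(s, t)\<in>D. M * (cmod (g t - g s) + cmod (h t - h s)))"
      using D le by (intro sum_mono) auto
    also have "\<dots> = M * ((\<Sum>(s, t)\<in>D. cmod (g t - g s)) + (\<Sum>(s, t)\<in>D. cmod (h t - h s)))"
      by (simp add: case_prod_unfold sum.distrib flip: sum_distrib_left)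
    also have "\<dots> \<le> M * (e' + e')"
      using d1[OF D disj] d2[OF D disj] len \<open>M \<ge> 0\<close> by (intro mult_left_mono) auto
    also have "\<dots> = M * e / (M + 1)"
    proof -
      have "e' + e' = e / (M + 1)" unfolding e'_def by (rule field_sum_of_halves)
      then show ?thesis by simp
    qed
    also have "\<dots> < e" using \<open>M \<ge> 0\<close> \<open>e > 0\<close> by (simp add: pos_divide_less_eq algebra_simps)
    finally show "(\<Sum>(s, t)\<in>D. cmod (k t - k s)) < e" .
  qed
qed

lemma abs_cont_on_const: "abs_cont_on J (\<lambda>x. c)"
  unfolding abs_cont_on_def by (auto intro: exI[of _ 1])

lemma abs_cont_on_of_real: "abs_cont_on J of_real"
  unfolding abs_cont_on_def
proof (intro allI impI)
  fix e :: real assume "e > 0"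
  have "(\<Sum>(s, t)\<in>D. cmod (of_real t - of_real s)) < e"
    if "\<forall>(s, t)\<in>D. s \<le> t \<and> {s..t} \<subseteq> J" "(\<Sum>(s, t)\<in>D. t - s) < e" for D
  proof -
    have "(\<Sum>(s, t)\<in>D. cmod (of_real t - of_real s)) = (\<Sum>(s, t)\<in>D. t - s)"
      using that(1) by (intro sum.cong) (auto simp flip: of_real_diff)
    with that(2) show ?thesis by simp
  qed
  then show "\<exists>d>0. \<forall>D. finite D \<longrightarrow> (\<forall>(s, t)\<in>D. s \<le> t \<and> {s..t} \<subseteq> J) \<longrightarrow>
      disjoint_family_on (\<lambda>(s, t). {s<..<t}) D \<longrightarrow> (\<Sum>(s, t)\<in>D. t - s) < d \<longrightarrow>
      (\<Sum>(s, t)\<in>D. cmod (of_real t - of_real s)) < e"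
    using \<open>e > 0\<close> by blast
qed

text \<open>Comparison with the identity, whose increments are the lengths of the intervals.\<close>

lemma lipschitz_imp_abs_cont_on:
  assumes "L-lipschitz_on J g"
  shows "abs_cont_on J g"
proof (rule abs_cont_on_dominated[OF abs_cont_on_of_real abs_cont_on_const lipschitz_on_nonneg[OF assms]])
  fix s t assume "s \<le> t" "{s..t} \<subseteq> J"
  then have "dist (g t) (g s) \<le> L * dist t s"
    by (intro lipschitz_onD[OF assms]) auto
  then show "cmod (g t - g s) \<le> L * (cmod (of_real t - of_real s) + cmod (0 - 0))"
    by (simp add: dist_norm flip: of_real_diff)
qed

lemma abs_cont_on_add:
  assumes "abs_cont_on J g" "abs_cont_on J h"
  shows "abs_cont_on J (\<lambda>x. g x + h x)"
  by (rule abs_cont_on_dominated[OF assms, of 1]) (auto simp: add_diff_add norm_triangle_ineq)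

lemma abs_cont_on_diff:
  assumes "abs_cont_on J g" "abs_cont_on J h"
  shows "abs_cont_on J (\<lambda>x. g x - h x)"
proof (rule abs_cont_on_dominated[OF assms, of 1])
  fix s t
  have eq: "g t - h t - (g s - h s) = (g t - g s) - (h t - h s)" by simp
  show "cmod (g t - h t - (g s - h s)) \<le> 1 * (cmod (g t - g s) + cmod (h t - h s))"
    using norm_triangle_ineq4[of "g t - g s" "h t - h s"] unfolding eq by simp
qed simp

lemma abs_cont_on_mult:
  assumes "abs_cont_on J g" "abs_cont_on J h"
    and bdd: "\<And>x. x \<in> J \<Longrightarrow> cmod (g x) \<le> M" "\<And>x. x \<in> J \<Longrightarrow> cmod (h x) \<le> M"
  shows "abs_cont_on J (\<lambda>x. g x * h x)"
proof (rule abs_cont_on_dominated[OF assms(1,2), of "\<bar>M\<bar>"])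
  fix s t assume "s \<le> t" "{s..t} \<subseteq> J"
  then have "cmod (g s) \<le> \<bar>M\<bar>" "cmod (h t) \<le> \<bar>M\<bar>"
    using bdd(1)[of s] bdd(2)[of t] by (auto simp: subset_iff)
  have "g t * h t - g s * h s = (g t - g s) * h t + g s * (h t - h s)" by (simp add: algebra_simps)
  also have "cmod \<dots> \<le> cmod (g t - g s) * cmod (h t) + cmod (g s) * cmod (h t - h s)"
    by (metis norm_mult norm_triangle_ineq)
  also have "\<dots> \<le> cmod (g t - g s) * \<bar>M\<bar> + \<bar>M\<bar> * cmod (h t - h s)"
    using \<open>cmod (g s) \<le> \<bar>M\<bar>\<close> \<open>cmod (h t) \<le> \<bar>M\<bar>\<close>
    by (simp add: add_mono mult_left_mono mult_right_mono)
  finally show "cmod (g t * h t - g s * h s) \<le> \<bar>M\<bar> * (cmod (g t - g s) + cmod (h t - h s))"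
    by (simp add: algebra_simps)
qed simp

lemma abs_cont_on_subset: "abs_cont_on J g \<Longrightarrow> J' \<subseteq> J \<Longrightarrow> abs_cont_on J' g"
  unfolding abs_cont_on_def
  by (elim all_forward imp_forward ex_forward conj_forward; (assumption | blast intro: subset_trans))

lemma abs_cont_on_mult_Icc:
  assumes "abs_cont_on {c..d} g" "abs_cont_on {c..d} h" "continuous_on {c..d} g" "continuous_on {c..d} h"
  shows "abs_cont_on {c..d} (\<lambda>x. g x * h x)"
proof -
  obtain B1 B2 where "\<forall>x\<in>{c..d}. cmod (g x) \<le> B1" "\<forall>x\<in>{c..d}. cmod (h x) \<le> B2"
    using assms(3,4)[THEN compact_continuous_image, THEN compact_imp_bounded]
    by (auto simp: bounded_iff)
  then show ?thesis
    by (intro abs_cont_on_mult[OF assms(1,2), of "max B1 B2"]) (auto simp: le_max_iff_disj)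
qed

section \<open>The space \<open>L\<^sub>2\<close> and its classes\<close>

lemma AE_lebesgue_on_iff_negligible:
  assumes "S \<in> sets lebesgue"
  shows "(AE x in lebesgue_on S. Q x) \<longleftrightarrow> negligible {x \<in> S. \<not> Q x}"
proof -
  have "(AE x in lebesgue_on S. Q x) \<longleftrightarrow> (AE x in lebesgue. x \<in> S \<longrightarrow> Q x)"
    using assms by (simp add: AE_restrict_space_iff)
  also have "\<dots> \<longleftrightarrow> {x \<in> space lebesgue. \<not> (x \<in> S \<longrightarrow> Q x)} \<in> null_sets lebesgue"
    by (rule completion.AE_iff_null_sets)
  finally show ?thesis by (simp add: negligible_iff_null_sets)
qed

text \<open>Lebesgue measure is complete: preimages under \<open>f\<close> and \<open>g\<close>
  differ only by subsets of a null set, and these are measurable.\<close>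

lemma borel_measurable_lebesgue_on_cong_AE:
  assumes f: "f \<in> borel_measurable (lebesgue_on S)" and S: "S \<in> sets lebesgue"
    and ae: "AE x in lebesgue_on S. f x = g x"
  shows "g \<in> borel_measurable (lebesgue_on S)"
proof (rule measurableI)
  fix A :: "'b set" assume A: "A \<in> sets borel"
  define N where "N = {x \<in> S. f x \<noteq> g x}"
  have N: "negligible N"
    using ae S by (simp add: AE_lebesgue_on_iff_negligible N_def)
  have null: "X \<in> sets (lebesgue_on S)" if "X \<subseteq> N" for X
    using that negligible_imp_sets[OF negligible_subset[OF N that]] S
    by (auto simp: sets_restrict_space_iff N_def)
  have "g -` A \<inter> space (lebesgue_on S) = (f -` A \<inter> space (lebesgue_on S) - N) \<union> (g -` A \<inter> N)"
    by (auto simp: N_def)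
  also have "\<dots> \<in> sets (lebesgue_on S)"
    using measurable_sets[OF f A] null by (intro sets.Un sets.Diff) auto
  finally show "g -` A \<inter> space (lebesgue_on S) \<in> sets (lebesgue_on S)" .
qed simp

lemma L2_cong_AE:
  assumes f: "f \<in> L2 P" and ae: "AE x in lebesgue_on {a_pt P..b_pt P}. f x = g x"
  shows "g \<in> L2 P"
proof -
  have g[measurable]: "g \<in> borel_measurable (lebesgue_on {a_pt P..b_pt P})"
    by (rule borel_measurable_lebesgue_on_cong_AE[OF _ _ ae]) (use f in \<open>simp_all add: L2_def\<close>)
  have "integrable (lebesgue_on {a_pt P..b_pt P}) (\<lambda>x. (cmod (g x))\<^sup>2)"
  proof (rule integrable_cong_AE_imp)
    show "integrable (lebesgue_on {a_pt P..b_pt P}) (\<lambda>x. (cmod (f x))\<^sup>2)"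
      using f by (simp add: L2_def)
    show "AE x in lebesgue_on {a_pt P..b_pt P}. (cmod (f x))\<^sup>2 = (cmod (g x))\<^sup>2"
      using ae by eventually_elim simp
  qed measurable
  then show ?thesis by (simp add: L2_def)
qed

lemma finite_measure_lebesgue_on_Icc: "finite_measure (lebesgue_on {a..b::real})"
  by (intro finite_measureI) (simp add: emeasure_restrict_space emeasure_lborel_Icc_eq)

lemma L2_lincomb:
  assumes "f \<in> L2 P" "g \<in> L2 P"
  shows "(\<lambda>x. c * f x + d * g x) \<in> L2 P"
proof -
  let ?M = "lebesgue_on {a_pt P..b_pt P}"
  have [measurable]: "f \<in> borel_measurable ?M" "g \<in> borel_measurable ?M"
    using assms by (auto simp: L2_def)
  have "integrable ?M (\<lambda>x. 2 * (cmod c)\<^sup>2 * (cmod (f x))\<^sup>2 + 2 * (cmod d)\<^sup>2 * (cmod (g x))\<^sup>2)"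
    using assms by (auto simp: L2_def)
  then have "integrable ?M (\<lambda>x. (cmod (c * f x + d * g x))\<^sup>2)"
  proof (rule Bochner_Integration.integrable_bound)
    have "(cmod (c * f x + d * g x))\<^sup>2 \<le> 2 * (cmod c)\<^sup>2 * (cmod (f x))\<^sup>2 + 2 * (cmod d)\<^sup>2 * (cmod (g x))\<^sup>2" for x
    proof -
      have "(cmod (c * f x + d * g x))\<^sup>2 \<le> (cmod (c * f x) + cmod (d * g x))\<^sup>2"
        by (intro power_mono norm_triangle_ineq) simp
      also have "\<dots> \<le> 2 * (cmod (c * f x))\<^sup>2 + 2 * (cmod (d * g x))\<^sup>2"
        using sum_squares_bound[of "cmod (c * f x)" "cmod (d * g x)"] by (simp add: power2_sum)
      finally show ?thesis by (simp add: norm_mult power_mult_distrib)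
    qed
    then show "AE x in ?M. norm ((cmod (c * f x + d * g x))\<^sup>2) \<le>
        norm (2 * (cmod c)\<^sup>2 * (cmod (f x))\<^sup>2 + 2 * (cmod d)\<^sup>2 * (cmod (g x))\<^sup>2)"
      by (intro always_eventually allI) (smt (verit) norm_of_real real_norm_def zero_le_power2)
  qed measurable
  then show ?thesis by (simp add: L2_def)
qed

lemma L2_cmult: "f \<in> L2 P \<Longrightarrow> (\<lambda>x. c * f x) \<in> L2 P"
  using L2_lincomb[of f P f c 0] by simp

lemma L2_diff: "f \<in> L2 P \<Longrightarrow> g \<in> L2 P \<Longrightarrow> (\<lambda>x. f x - g x) \<in> L2 P"
  using L2_lincomb[of f P g 1 "-1"] by simp

lemma bounded_mult_L2:
  assumes g: "g \<in> borel_measurable (lebesgue_on {a_pt P..b_pt P})"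
    and B: "\<And>x. x \<in> {a_pt P..b_pt P} \<Longrightarrow> cmod (g x) \<le> B" and f: "f \<in> L2 P"
  shows "(\<lambda>x. g x * f x) \<in> L2 P"
proof -
  let ?M = "lebesgue_on {a_pt P..b_pt P}"
  have [measurable]: "f \<in> borel_measurable ?M" "g \<in> borel_measurable ?M"
    using f g by (auto simp: L2_def)
  have "integrable ?M (\<lambda>x. B\<^sup>2 * (cmod (f x))\<^sup>2)"
    using f by (auto simp: L2_def)
  then have "integrable ?M (\<lambda>x. (cmod (g x * f x))\<^sup>2)"
  proof (rule Bochner_Integration.integrable_bound)
    show "AE x in ?M. norm ((cmod (g x * f x))\<^sup>2) \<le> norm (B\<^sup>2 * (cmod (f x))\<^sup>2)"
    proof (rule AE_I2)
      fix x assume "x \<in> space ?M"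
      then have "(cmod (g x))\<^sup>2 \<le> B\<^sup>2" using B by (intro power_mono) auto
      then show "norm ((cmod (g x * f x))\<^sup>2) \<le> norm (B\<^sup>2 * (cmod (f x))\<^sup>2)"
        by (simp add: norm_mult power_mult_distrib mult_right_mono)
    qed
  qed measurable
  then show ?thesis by (simp add: L2_def)
qed

lemma const_L2: "(\<lambda>x. c) \<in> L2 P"
  using finite_measure.integrable_const[OF finite_measure_lebesgue_on_Icc] by (simp add: L2_def)

lemma bounded_imp_L2:
  assumes "g \<in> borel_measurable (lebesgue_on {a_pt P..b_pt P})"
    and "\<And>x. x \<in> {a_pt P..b_pt P} \<Longrightarrow> cmod (g x) \<le> B"
  shows "g \<in> L2 P"
  using bounded_mult_L2[OF assms const_L2[of 1]] by simp

lemma L2_integrable: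
  assumes "f \<in> L2 P"
  shows "integrable (lebesgue_on {a_pt P..b_pt P}) f"
proof -
  let ?M = "lebesgue_on {a_pt P..b_pt P}"
  interpret finite_measure ?M by (rule finite_measure_lebesgue_on_Icc)
  have "integrable ?M (\<lambda>x. 1 + (cmod (f x))\<^sup>2)" using assms by (auto simp: L2_def)
  then show ?thesis
  proof (rule Bochner_Integration.integrable_bound)
    have "cmod (f x) \<le> 1 + (cmod (f x))\<^sup>2" for x
      using sum_squares_bound[of 1 "cmod (f x)"] norm_ge_zero[of "f x"] unfolding power_one by linarith
    then show "AE x in ?M. cmod (f x) \<le> norm (1 + (cmod (f x))\<^sup>2)" by simp
  qed (use assms in \<open>simp add: L2_def\<close>)
qed

lemma L2_integrable_on:
  assumes "f \<in> L2 P"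
  shows "f absolutely_integrable_on {a_pt P..b_pt P}" "(\<lambda>x. (cmod (f x))\<^sup>2) integrable_on {a_pt P..b_pt P}"
proof -
  show "f absolutely_integrable_on {a_pt P..b_pt P}"
    using L2_integrable[OF assms] by (simp add: set_integrable_def integrable_restrict_space)
  show "(\<lambda>x. (cmod (f x))\<^sup>2) integrable_on {a_pt P..b_pt P}"
    using assms by (intro integrable_on_lebesgue_on) (simp_all add: L2_def)
qed

lemma equiv_ae_rel: "equiv (L2 P) (ae_rel P)"
proof (rule equivI)
  show "ae_rel P \<subseteq> L2 P \<times> L2 P" unfolding ae_rel_def by blast
  show "refl_on (L2 P) (ae_rel P)" by (simp add: refl_on_def ae_rel_def)
  show "sym (ae_rel P)" by (auto simp: sym_def ae_rel_def eq_commute)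
  show "trans (ae_rel P)"
  proof (rule transI)
    fix f g h assume *: "(f, g) \<in> ae_rel P" "(g, h) \<in> ae_rel P"
    then have "AE x in lebesgue_on {a_pt P..b_pt P}. f x = g x" "AE x in lebesgue_on {a_pt P..b_pt P}. g x = h x"
      by (simp_all add: ae_rel_def)
    then have "AE x in lebesgue_on {a_pt P..b_pt P}. f x = h x"
      by eventually_elim simp
    with * show "(f, h) \<in> ae_rel P" by (simp add: ae_rel_def)
  qed
qed

lemma cls_eq_iff:
  assumes "f \<in> L2 P" "g \<in> L2 P"
  shows "cls P f = cls P g \<longleftrightarrow> (AE x in lebesgue_on {a_pt P..b_pt P}. f x = g x)"
  using eq_equiv_class_iff[OF equiv_ae_rel assms] assms by (simp add: cls_def ae_rel_def)

lemma cls_cong_AE: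
  assumes "f \<in> L2 P" "AE x in lebesgue_on {a_pt P..b_pt P}. f x = g x"
  shows "cls P f = cls P g"
  using assms cls_eq_iff L2_cong_AE by blast

text \<open>\<open>H_scale\<close> and \<open>H_minus\<close> compute with the arbitrary choice
  \<open>rep\<close>; this allows any convenient member of the class to replace it.\<close>

lemma rep_cls:
  assumes "f \<in> L2 P"
  shows "rep (cls P f) \<in> L2 P" "AE x in lebesgue_on {a_pt P..b_pt P}. f x = rep (cls P f) x"
proof -
  have mem_iff: "g \<in> cls P f \<longleftrightarrow> f \<in> L2 P \<and> g \<in> L2 P \<and> (AE x in lebesgue_on {a_pt P..b_pt P}. f x = g x)" for g
    by (simp add: cls_def ae_rel_def)
  have "f \<in> cls P f" unfolding mem_iff using assms by simp
  then have "\<exists>g. g \<in> cls P f" by blast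
  then have "rep (cls P f) \<in> cls P f" unfolding rep_def by (rule someI_ex)
  then show "rep (cls P f) \<in> L2 P" "AE x in lebesgue_on {a_pt P..b_pt P}. f x = rep (cls P f) x"
    unfolding mem_iff by simp_all
qed

lemma H_space_eq: "H_space P = (cls P ` L2 P) \<times> UNIV"
proof -
  have "L2 P // ae_rel P = cls P ` L2 P" unfolding quotient_def cls_def by blast
  then show ?thesis by (simp add: H_space_def)
qed

lemma H_scale_cls:
  assumes "f \<in> L2 P"
  shows "H_scale P l (cls P f, z) = (cls P (\<lambda>x. l * f x), l * z)"
proof -
  have "AE x in lebesgue_on {a_pt P..b_pt P}. l * f x = l * rep (cls P f) x"
    using rep_cls(2)[OF assms] by eventually_elim simp
  from cls_cong_AE[OF L2_cmult[OF assms] this] show ?thesis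
    by (simp add: H_scale_def)
qed

lemma H_minus_cls:
  assumes "f \<in> L2 P" "g \<in> L2 P"
  shows "H_minus P (cls P f, z) (cls P g, w) = (cls P (\<lambda>x. f x - g x), z - w)"
proof -
  have "AE x in lebesgue_on {a_pt P..b_pt P}. f x - g x = rep (cls P f) x - rep (cls P g) x"
    using rep_cls(2)[OF assms(1)] rep_cls(2)[OF assms(2)] by eventually_elim simp
  from cls_cong_AE[OF L2_diff[OF assms] this] show ?thesis
    by (simp add: H_minus_def)
qed

section \<open>Geometry of the three pieces\<close>

locale SL_transmission =
  fixes P :: SL_data
  assumes SL: "SL_problem P"
begin

abbreviation "a \<equiv> a_pt P"
abbreviation "b \<equiv> b_pt P"
abbreviation "tm \<equiv> theta_m P"
abbreviation "tp \<equiv> theta_p P"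
abbreviation "I \<equiv> I_dom P"

lemma order: "a < tm" "tm < tp" "tp < b" "a < tp" "tm < b" "a < b"
  using SL by (auto simp: SL_problem_def theta_m_def theta_p_def field_simps)

lemma D_pos: "D1 P > 0" "D2 P > 0" "rho P > 0"
  using SL by (auto simp: SL_problem_def)

lemma I_eq: "I = {a..b} - {tm, tp}"
  using order by (auto simp: I_dom_def)

lemma end_points_in_I: "a \<in> I" "b \<in> I"
  using order by (auto simp: I_eq)

text \<open>The two removed points keep a positive distance from \<open>x\<close>, so derivatives
  within \<open>I\<close> can be computed within \<open>{a..b}\<close>.\<close>

lemma at_within_I: "x \<in> I \<Longrightarrow> at x within I = at x within {a..b}"
  by (rule at_within_nhd[of x "- {tm, tp}"]) (auto simp: I_eq)

lemma at_within_I_interior: "x \<in> I \<Longrightarrow> a < x \<Longrightarrow> x < b \<Longrightarrow> at x within I = at x"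
  by (simp add: at_within_I at_within_Icc_at)

lemma at_within_I_neq_bot: "x \<in> I \<Longrightarrow> at x within I \<noteq> bot"
proof -
  assume x: "x \<in> I"
  then have "x islimpt {a..b}" using order by (simp add: I_eq islimpt_Icc)
  then show ?thesis by (simp only: at_within_I[OF x] trivial_limit_within not_not)
qed

lemma der_eqI: "(u has_vector_derivative D) (at x within I) \<Longrightarrow> x \<in> I \<Longrightarrow> der P u x = D"
  unfolding der_def by (rule vector_derivative_within[OF at_within_I_neq_bot])

lemma der_works:
  "u differentiable (at x within I) \<Longrightarrow> (u has_vector_derivative der P u x) (at x within I)"
  unfolding der_def by (simp add: vector_derivative_works)

lemma has_vector_derivative_cong_I:
  assumes "\<And>y. y \<in> I \<Longrightarrow> u y = v y" "x \<in> I"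
  shows "(u has_vector_derivative D) (at x within I) \<longleftrightarrow> (v has_vector_derivative D) (at x within I)"
  using has_vector_derivative_transform[of x I u v D] has_vector_derivative_transform[of x I v u D] assms
  by auto

lemma der_cong:
  assumes "\<And>y. y \<in> I \<Longrightarrow> u y = v y" "x \<in> I"
  shows "der P u x = der P v x"
  unfolding der_def vector_derivative_def by (simp only: has_vector_derivative_cong_I[OF assms])

lemma tau_cong:
  assumes "\<And>y. y \<in> I \<Longrightarrow> u y = v y" "x \<in> I"
  shows "tau P u x = tau P v x"
  unfolding tau_def using assms der_cong[OF der_cong[OF assms(1)] assms(2)] by simp

lemma R_form_cong:
  assumes "\<And>y. y \<in> I \<Longrightarrow> u y = v y"
  shows "R_form P u = R_form P v" "R'_form P u = R'_form P v"
  using assms end_points_in_I der_cong[OF assms end_points_in_I(2)] by (simp_all add: R_form_def R'_form_def)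

text \<open>A piece is given by its end points, so that arguments about a closed piece and its two
  end limits are made once for all three.\<close>

definition piece :: "real \<Rightarrow> real \<Rightarrow> bool" where
  "piece c d \<longleftrightarrow> (c, d) \<in> {(a, tm), (tm, tp), (tp, b)}"

lemma piece_cases:
  assumes "piece c d"
  obtains "c = a" "d = tm" | "c = tm" "d = tp" | "c = tp" "d = b"
  using assms by (auto simp: piece_def)

lemma piece_simps [simp]: "piece a tm" "piece tm tp" "piece tp b"
  by (simp_all add: piece_def)

lemma piece_order: "piece c d \<Longrightarrow> c < d \<and> a \<le> c \<and> d \<le> b"
  using order by (auto simp: piece_def)

lemma piece_subset_I: "piece c d \<Longrightarrow> {c<..<d} \<subseteq> I"
  using order by (auto simp: piece_def I_eq)

lemma I_in_piece: assumes "x \<in> I" obtains c d where "piece c d" "x \<in> {c..d}"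
proof -
  have "x \<in> {a..tm} \<or> x \<in> {tm..tp} \<or> x \<in> {tp..b}" using assms by (auto simp: I_eq)
  then show thesis using that piece_simps by blast
qed

text \<open>Mean value arguments need a convex set, and \<open>I\<close> is disconnected; these sets
  are its components.\<close>

lemma convex_piece: "piece c d \<Longrightarrow> convex ({c..d} \<inter> I)"
proof (erule piece_cases)
  assume "c = a" "d = tm"
  then have "{c..d} \<inter> I = {a..<tm}" using order by (auto simp: I_eq)
  then show ?thesis by simp
next
  assume "c = tm" "d = tp"
  then have "{c..d} \<inter> I = {tm<..<tp}" using order by (auto simp: I_eq)
  then show ?thesis by simp
next
  assume "c = tp" "d = b"
  then have "{c..d} \<inter> I = {tp<..b}" using order by (auto simp: I_eq)
  then show ?thesis by simp
qed

lemma closure_piece: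
  assumes "piece c d"
  shows "closure ({c..d} \<inter> I) = {c..d}"
proof
  show "closure ({c..d} \<inter> I) \<subseteq> {c..d}" by (rule closure_minimal) auto
  have "{c<..<d} \<subseteq> {c..d} \<inter> I" using piece_subset_I[OF assms] by auto
  then have "closure {c<..<d} \<subseteq> closure ({c..d} \<inter> I)" by (rule closure_mono)
  then show "{c..d} \<subseteq> closure ({c..d} \<inter> I)" using piece_order[OF assms] by simp
qed

lemma eventually_in_I:
  "eventually (\<lambda>x. x \<in> I) (at_left tm)" "eventually (\<lambda>x. x \<in> I) (at_right tm)"
  "eventually (\<lambda>x. x \<in> I) (at_left tp)" "eventually (\<lambda>x. x \<in> I) (at_right tp)"
proof -
  show "eventually (\<lambda>x. x \<in> I) (at_left tm)"
    using eventually_at_left_real[OF order(1)] by eventually_elim (use order in \<open>auto simp: I_eq\<close>)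
  show "eventually (\<lambda>x. x \<in> I) (at_right tm)"
    using eventually_at_right_real[OF order(2)] by eventually_elim (use order in \<open>auto simp: I_eq\<close>)
  show "eventually (\<lambda>x. x \<in> I) (at_left tp)"
    using eventually_at_left_real[OF order(2)] by eventually_elim (use order in \<open>auto simp: I_eq\<close>)
  show "eventually (\<lambda>x. x \<in> I) (at_right tp)"
    using eventually_at_right_real[OF order(3)] by eventually_elim (use order in \<open>auto simp: I_eq\<close>)
qed

lemma negligible_outside_I: "negligible ({a..b} - I)"
  by (rule negligible_subset[of "{tm, tp}"]) (auto simp: I_eq)

lemma AE_iff_negligible: "(AE x in lebesgue_on {a..b}. Q x) \<longleftrightarrow> negligible {x \<in> {a..b}. \<not> Q x}"
  by (rule AE_lebesgue_on_iff_negligible) simp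

lemma AE_I: "(\<And>x. x \<in> I \<Longrightarrow> Q x) \<Longrightarrow> AE x in lebesgue_on {a..b}. Q x"
  unfolding AE_iff_negligible by (rule negligible_subset[OF negligible_outside_I]) auto

section \<open>Functions with one-sided limits at the interfaces\<close>

text \<open>This amounts to a continuous extension to each closed piece. The values at
  \<open>tm\<close> and \<open>tp\<close> themselves stay arbitrary.\<close>

definition regular :: "(real \<Rightarrow> 'a::real_normed_vector) \<Rightarrow> bool" where
  "regular g \<longleftrightarrow> continuous_on I g \<and> (\<exists>l. (g \<longlongrightarrow> l) (at_left tm)) \<and> (\<exists>l. (g \<longlongrightarrow> l) (at_right tm)) \<and>
     (\<exists>l. (g \<longlongrightarrow> l) (at_left tp)) \<and> (\<exists>l. (g \<longlongrightarrow> l) (at_right tp))"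

lemma regular_end_limits:
  assumes "regular g"
  shows "(g \<longlongrightarrow> g a) (at_right a)" "(g \<longlongrightarrow> g b) (at_left b)"
proof -
  have *: "(g \<longlongrightarrow> g x) (at x within {a..b})" if "x \<in> I" for x
    using assms that at_within_I[OF that] unfolding regular_def continuous_on_def by metis
  show "(g \<longlongrightarrow> g a) (at_right a)" "(g \<longlongrightarrow> g b) (at_left b)"
    using *[OF end_points_in_I(1)] *[OF end_points_in_I(2)] order(6)
    by (simp_all add: at_within_Icc_at_right at_within_Icc_at_left)
qed

lemma regular_piece_limits:
  assumes "regular g" "piece c d"
  shows "\<exists>l. (g \<longlongrightarrow> l) (at_right c)" "\<exists>l. (g \<longlongrightarrow> l) (at_left d)"
  using assms regular_end_limits[OF assms(1)] by (auto simp: regular_def piece_def)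

lemma regular_bounded:
  assumes "regular g"
  obtains B where "B > 0" "\<And>x. x \<in> {a..b} \<Longrightarrow> norm (g x) \<le> B"
proof -
  have bdd: "bounded (g ` {c<..<d})" if pc: "piece c d" for c d
  proof -
    have cd: "c < d" using piece_order[OF pc] by simp
    obtain l r where l: "(g \<longlongrightarrow> l) (at_right c)" and r: "(g \<longlongrightarrow> r) (at_left d)"
      using regular_piece_limits[OF assms pc] by auto
    \<comment> \<open>Replacing the end values by the one-sided limits gives a continuous function
      on a compact interval.\<close>
    define h where "h = (\<lambda>x. if x = c then l else if x = d then r else g x)"
    have "continuous_on {c..d} h"
    proof (rule continuous_on_IccI[OF _ _ _ cd])
      have "\<forall>\<^sub>F x in at_right c. g x = h x"
        using eventually_at_right_real[OF cd] by eventually_elim (auto simp: h_def)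
      then show "(h \<longlongrightarrow> h c) (at_right c)"
        using l by (subst tendsto_cong[symmetric]) (auto simp: h_def)
      have "\<forall>\<^sub>F x in at_left d. g x = h x"
        using eventually_at_left_real[OF cd] by eventually_elim (auto simp: h_def)
      then show "(h \<longlongrightarrow> h d) (at_left d)"
        using r cd by (subst tendsto_cong[symmetric]) (auto simp: h_def)
      fix x assume x: "c < x" "x < d"
      have "continuous_on {c<..<d} g"
        using assms piece_subset_I[OF pc] continuous_on_subset unfolding regular_def by blast
      then have "(g \<longlongrightarrow> g x) (at x)"
        using x by (simp add: continuous_on_eq_continuous_at isCont_def)
      moreover have "\<forall>\<^sub>F y in at x. g y = h y"
        by (rule eventually_at_in_open'[of "{c<..<d}", THEN eventually_mono]) (use x in \<open>auto simp: h_def\<close>)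
      ultimately show "h \<midarrow>x\<rightarrow> h x"
        using x by (subst tendsto_cong[symmetric]) (auto simp: h_def)
    qed
    then have "bounded (h ` {c..d})"
      by (intro compact_imp_bounded compact_continuous_image) auto
    moreover have "g ` {c<..<d} \<subseteq> h ` {c..d}" by (auto simp: h_def intro!: image_eqI)
    ultimately show ?thesis by (rule bounded_subset)
  qed
  \<comment> \<open>The open pieces leave out four points, which add only finitely many
    values.\<close>
  have "bounded (g ` {a<..<tm} \<union> g ` {tm<..<tp} \<union> g ` {tp<..<b} \<union> g ` {a, tm, tp, b})"
    using bdd by (simp add: finite_imp_bounded)
  moreover have "g ` {a..b} \<subseteq> g ` {a<..<tm} \<union> g ` {tm<..<tp} \<union> g ` {tp<..<b} \<union> g ` {a, tm, tp, b}"
    by force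
  ultimately have "bounded (g ` {a..b})" by (rule bounded_subset)
  then obtain B where "B > 0" "\<forall>y \<in> g ` {a..b}. norm y \<le> B"
    using bounded_pos by blast
  then show thesis using that by blast
qed

lemma regular_measurable:
  assumes "regular g"
  shows "g \<in> borel_measurable (lebesgue_on {a..b})"
proof (rule borel_measurable_lebesgue_on_cong_AE)
  have "(\<lambda>x. indicator I x *\<^sub>R g x) \<in> borel_measurable borel"
    using assms by (intro borel_measurable_continuous_on_indicator) (auto simp: regular_def I_eq)
  then show "(\<lambda>x. indicator I x *\<^sub>R g x) \<in> borel_measurable (lebesgue_on {a..b})"
    by (intro measurable_restrict_space1 measurable_completion) simp
  show "AE x in lebesgue_on {a..b}. indicator I x *\<^sub>R g x = g x"
    by (rule AE_I) simp
qed simp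

lemma regular_imp_L2: "regular g \<Longrightarrow> g \<in> L2 P"
  by (metis regular_bounded regular_measurable bounded_imp_L2)

lemma regular_pot: "regular (pot P)"
proof -
  have "continuous_on I (pot P)"
    unfolding continuous_on_def
  proof
    fix x assume "x \<in> I"
    then consider "x \<in> {a..<tm}" | "x \<in> {tm<..<tp}" | "x \<in> {tp<..b}" by (auto simp: I_dom_def)
    then show "(pot P \<longlongrightarrow> pot P x) (at x within I)"
    proof cases
      case 1
      then have "at x within I = at x within {a..<tm}"
        using order by (intro at_within_nhd[of x "{..<tm}"]) (auto simp: I_dom_def)
      with 1 show ?thesis using SL unfolding SL_problem_def continuous_on_def by simp
    next
      case 2
      then have "at x within I = at x within {tm<..<tp}"
        using order by (intro at_within_nhd[of x "{tm<..<tp}"]) (auto simp: I_dom_def)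
      with 2 show ?thesis using SL unfolding SL_problem_def continuous_on_def by simp
    next
      case 3
      then have "at x within I = at x within {tp<..b}"
        using order by (intro at_within_nhd[of x "{tp<..}"]) (auto simp: I_dom_def)
      with 3 show ?thesis using SL unfolding SL_problem_def continuous_on_def by simp
    qed
  qed
  then show ?thesis using SL by (auto simp: regular_def SL_problem_def)
qed

text \<open>A bounded derivative gives the Lipschitz property on the convex part inside
  \<open>I\<close>; uniform continuity extends the function to the closure with the same constant.
  The extension is a witness of the kind that \<open>piece_abs_cont\<close> asks for.\<close>

lemma lipschitz_on_piece:
  assumes pc: "piece c d" and B: "B \<ge> 0"
    and g: "\<And>x. x \<in> I \<Longrightarrow> (g has_vector_derivative g' x) (at x within I)"
    and le: "\<And>x. x \<in> I \<Longrightarrow> cmod (g' x) \<le> B"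
  obtains h where "B-lipschitz_on {c..d} h" "\<And>x. x \<in> {c..d} \<inter> I \<Longrightarrow> h x = g x"
proof -
  let ?K = "{c..d} \<inter> I"
  have lip: "B-lipschitz_on ?K g"
  proof (rule bounded_derivative_imp_lipschitz)
    fix x assume "x \<in> ?K"
    then show "(g has_derivative (\<lambda>h. h *\<^sub>R g' x)) (at x within ?K)"
      using has_vector_derivative_within_subset[OF g] unfolding has_vector_derivative_def by auto
    show "onorm (\<lambda>h. h *\<^sub>R g' x) \<le> B"
      using le[of x] \<open>x \<in> ?K\<close> by (intro onorm_bound B) (auto simp: mult.commute[of B] mult_left_mono)
  qed (use convex_piece[OF pc] B in auto)
  obtain h where h: "uniformly_continuous_on (closure ?K) h" "\<And>x. x \<in> ?K \<Longrightarrow> g x = h x"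
    using uniformly_continuous_on_extension_on_closure[OF lipschitz_on_uniformly_continuous[OF lip]] by metis
  have "B-lipschitz_on ?K h" using lip h(2) by (simp add: lipschitz_on_def)
  then have "B-lipschitz_on (closure ?K) h"
    using h(1) by (intro lipschitz_on_closure uniformly_continuous_imp_continuous)
  then show thesis using h(2) closure_piece[OF pc] by (intro that) auto
qed

section \<open>Solutions of the homogeneous equation\<close>

lemma solves_has_derivatives:
  assumes "solves P lam w" "x \<in> I"
  shows "(w has_vector_derivative der P w x) (at x within I)"
    and "(der P w has_vector_derivative (of_real (pot P x) - lam) * w x) (at x within I)"
proof -
  have d: "w differentiable (at x within I)" "der P w differentiable (at x within I)"
    and t: "tau P w x = lam * w x"
    using assms by (auto simp: solves_def)
  show "(w has_vector_derivative der P w x) (at x within I)" by (rule der_works[OF d(1)])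
  have "der P (der P w) x = (of_real (pot P x) - lam) * w x"
    using t by (simp add: tau_def algebra_simps)
  then show "(der P w has_vector_derivative (of_real (pot P x) - lam) * w x) (at x within I)"
    using der_works[OF d(2)] by simp
qed

lemma has_vector_derivative_imp_continuous_on_I:
  assumes "\<And>x. x \<in> I \<Longrightarrow> (w has_vector_derivative w' x) (at x within I)"
  shows "continuous_on I w"
  using assms has_vector_derivative_continuous continuous_on_eq_continuous_within by blast

lemma transmission_limits:
  assumes "transmission P w"
  shows "\<exists>l. (w \<longlongrightarrow> l) (at_left tm)" "\<exists>l. (w \<longlongrightarrow> l) (at_right tm)"
    "\<exists>l. (w \<longlongrightarrow> l) (at_left tp)" "\<exists>l. (w \<longlongrightarrow> l) (at_right tp)"
    "\<exists>l. (der P w \<longlongrightarrow> l) (at_left tm)" "\<exists>l. (der P w \<longlongrightarrow> l) (at_right tm)"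
    "\<exists>l. (der P w \<longlongrightarrow> l) (at_left tp)" "\<exists>l. (der P w \<longlongrightarrow> l) (at_right tp)"
  using assms unfolding transmission_def transmits_def by blast+

lemma solution_regular:
  assumes "solves P lam w" "transmission P w"
  shows "regular w" "regular (der P w)"
proof -
  show "regular w"
    unfolding regular_def using transmission_limits[OF assms(2)]
      has_vector_derivative_imp_continuous_on_I[OF solves_has_derivatives(1)[OF assms(1)]] by blast
  show "regular (der P w)"
    unfolding regular_def using transmission_limits[OF assms(2)]
      has_vector_derivative_imp_continuous_on_I[OF solves_has_derivatives(2)[OF assms(1)]] by blast
qed

lemma solution_lipschitz:
  assumes w: "solves P lam w" "transmission P w" and pc: "piece c d"
  obtains L h h' where "L-lipschitz_on {c..d} h" "\<And>x. x \<in> {c..d} \<inter> I \<Longrightarrow> h x = w x"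
    "L-lipschitz_on {c..d} h'" "\<And>x. x \<in> {c..d} \<inter> I \<Longrightarrow> h' x = der P w x"
proof -
  obtain B1 where B1: "B1 > 0" "\<And>x. x \<in> {a..b} \<Longrightarrow> cmod (w x) \<le> B1"
    using regular_bounded[OF solution_regular(1)[OF w]] by blast
  obtain B2 where B2: "B2 > 0" "\<And>x. x \<in> {a..b} \<Longrightarrow> cmod (der P w x) \<le> B2"
    using regular_bounded[OF solution_regular(2)[OF w]] by blast
  obtain B3 where B3: "B3 > 0" "\<And>x. x \<in> {a..b} \<Longrightarrow> norm (pot P x) \<le> B3"
    using regular_bounded[OF regular_pot] by blast
  \<comment> \<open>\<open>B2\<close> bounds \<open>w'\<close> and
    \<open>(B3 + cmod lam) * B1\<close> bounds \<open>w'' = (q - lam) w\<close>, so the sum is a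
    Lipschitz constant for both \<open>w\<close> and \<open>w'\<close>.\<close>
  define L where "L = B2 + (B3 + cmod lam) * B1"
  have nn: "(B3 + cmod lam) * B1 \<ge> 0" using B1 B3 by simp
  then have "L \<ge> 0" using B2 by (simp add: L_def)
  obtain h where h: "L-lipschitz_on {c..d} h" "\<And>x. x \<in> {c..d} \<inter> I \<Longrightarrow> h x = w x"
  proof (rule lipschitz_on_piece[OF pc \<open>L \<ge> 0\<close> solves_has_derivatives(1)[OF w(1)]])
    fix x assume "x \<in> I"
    then have "cmod (der P w x) \<le> B2" using B2(2)[of x] by (simp add: I_eq)
    then show "cmod (der P w x) \<le> L" using nn by (simp add: L_def)
  qed (assumption, rule that)
  obtain h' where h': "L-lipschitz_on {c..d} h'" "\<And>x. x \<in> {c..d} \<inter> I \<Longrightarrow> h' x = der P w x"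
  proof (rule lipschitz_on_piece[OF pc \<open>L \<ge> 0\<close> solves_has_derivatives(2)[OF w(1)]])
    fix x assume "x \<in> I"
    then have x: "x \<in> {a..b}" by (simp add: I_eq)
    have "cmod (of_real (pot P x) - lam) \<le> B3 + cmod lam"
      using norm_triangle_ineq4[of "of_real (pot P x)" lam] B3(2)[OF x] by simp
    then have "cmod ((of_real (pot P x) - lam) * w x) \<le> (B3 + cmod lam) * B1"
      unfolding norm_mult using B1 B3 x by (intro mult_mono) auto
    then show "cmod ((of_real (pot P x) - lam) * w x) \<le> L" using B2 by (simp add: L_def)
  qed (assumption, rule that)
  show thesis by (rule that[OF h h'])
qed

section \<open>The Wronskian and its jumps at the interfaces\<close>

definition wronskian :: "(real \<Rightarrow> complex) \<Rightarrow> (real \<Rightarrow> complex) \<Rightarrow> real \<Rightarrow> complex" where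
  "wronskian u v x = u x * der P v x - der P u x * v x"

text \<open>Both functions satisfy \<open>w'' = (q - lam) w\<close> with the same
  \<open>lam\<close>, so the derivative \<open>u v'' - u'' v\<close> cancels.\<close>

lemma wronskian_const_on_piece:
  assumes u: "solves P lam u" and v: "solves P lam v" and pc: "piece c d"
  obtains k where "\<And>x. x \<in> {c..d} \<inter> I \<Longrightarrow> wronskian u v x = k"
proof -
  have "\<exists>k. \<forall>x\<in>{c..d} \<inter> I. wronskian u v x = k"
  proof (rule has_derivative_zero_constant[OF convex_piece[OF pc]])
    fix x assume x: "x \<in> {c..d} \<inter> I"
    note d = solves_has_derivatives[OF u, of x] solves_has_derivatives[OF v, of x]
    have "(wronskian u v has_vector_derivative
        (u x * ((of_real (pot P x) - lam) * v x) + der P u x * der P v x) -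
        (der P u x * der P v x + (of_real (pot P x) - lam) * u x * v x)) (at x within I)"
      unfolding wronskian_def using d x
      by (intro has_vector_derivative_diff has_vector_derivative_mult) auto
    then have "(wronskian u v has_vector_derivative 0) (at x within I)"
      by (simp add: algebra_simps)
    then have "(wronskian u v has_vector_derivative 0) (at x within {c..d} \<inter> I)"
      by (rule has_vector_derivative_within_subset) auto
    then show "(wronskian u v has_derivative (\<lambda>h. 0)) (at x within {c..d} \<inter> I)"
      by (simp add: has_vector_derivative_def)
  qed
  then show thesis using that by blast
qed

text \<open>The Wronskian is the determinant of the matrix with columns \<open>(u, u')\<close> and
  \<open>(v, v')\<close>. Crossing the interface multiplies this matrix by the transmission matrix,
  hence the Wronskian by the determinant of the latter.\<close>

lemma transmits_wronskian:
  assumes u: "transmits P t m1 m2 m1' m2' u" and v: "transmits P t m1 m2 m1' m2' v"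
    and l: "eventually (\<lambda>x. wronskian u v x = kl) (at_left t)"
    and r: "eventually (\<lambda>x. wronskian u v x = kr) (at_right t)"
  shows "kr = of_real (m1 * m2' - m2 * m1') * kl"
proof -
  obtain ul ul' ur ur' where U: "(u \<longlongrightarrow> ul) (at_left t)" "(der P u \<longlongrightarrow> ul') (at_left t)"
    "(u \<longlongrightarrow> ur) (at_right t)" "(der P u \<longlongrightarrow> ur') (at_right t)"
    "ur = of_real m1 * ul + of_real m2 * ul'" "ur' = of_real m1' * ul + of_real m2' * ul'"
    using u unfolding transmits_def by blast
  obtain vl vl' vr vr' where V: "(v \<longlongrightarrow> vl) (at_left t)" "(der P v \<longlongrightarrow> vl') (at_left t)"
    "(v \<longlongrightarrow> vr) (at_right t)" "(der P v \<longlongrightarrow> vr') (at_right t)"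
    "vr = of_real m1 * vl + of_real m2 * vl'" "vr' = of_real m1' * vl + of_real m2' * vl'"
    using v unfolding transmits_def by blast
  have "(wronskian u v \<longlongrightarrow> ul * vl' - ul' * vl) (at_left t)"
    unfolding wronskian_def by (intro tendsto_intros U V)
  moreover have "(wronskian u v \<longlongrightarrow> kl) (at_left t)"
    by (rule tendsto_eventually[OF l])
  ultimately have kl: "kl = ul * vl' - ul' * vl"
    by (intro tendsto_unique[of "at_left t" "wronskian u v"]) auto
  have "(wronskian u v \<longlongrightarrow> ur * vr' - ur' * vr) (at_right t)"
    unfolding wronskian_def by (intro tendsto_intros U V)
  moreover have "(wronskian u v \<longlongrightarrow> kr) (at_right t)"
    by (rule tendsto_eventually[OF r])
  ultimately have "kr = ur * vr' - ur' * vr"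
    by (intro tendsto_unique[of "at_right t" "wronskian u v"]) auto
  then show ?thesis unfolding kl U(5,6) V(5,6) by (simp add: algebra_simps)
qed

text \<open>The weight of the inner product of \<open>H\<close>; it is the reciprocal of the growth of the Wronskian.\<close>

definition wt :: "real \<Rightarrow> complex" where
  "wt x = (if x \<le> tm then 1 else if x \<le> tp then of_real (1 / D1 P) else of_real (1 / (D1 P * D2 P)))"

text \<open>The weight divides out the jump factors \<open>D1 P\<close> and \<open>D2 P\<close>, and
  \<open>omega\<close> is the value of the Wronskian at \<open>a\<close>, where the weight is
  1.\<close>

lemma wt_wronskian:
  assumes u: "solves P lam u" "transmission P u" and v: "solves P lam v" "transmission P v"
    and x: "x \<in> I"
  shows "wt x * wronskian u v x = omega P u v"
proof -
  obtain k1 where k1: "\<And>x. x \<in> {a..tm} \<inter> I \<Longrightarrow> wronskian u v x = k1"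
    using wronskian_const_on_piece[OF u(1) v(1), of a tm] by auto
  obtain k2 where k2: "\<And>x. x \<in> {tm..tp} \<inter> I \<Longrightarrow> wronskian u v x = k2"
    using wronskian_const_on_piece[OF u(1) v(1), of tm tp] by auto
  obtain k3 where k3: "\<And>x. x \<in> {tp..b} \<inter> I \<Longrightarrow> wronskian u v x = k3"
    using wronskian_const_on_piece[OF u(1) v(1), of tp b] by auto
  have k1_omega: "k1 = omega P u v"
    using k1[of a] end_points_in_I order by (simp add: omega_def wronskian_def)
  have "k2 = of_real (D1 P) * k1"
    unfolding D1_def
  proof (rule transmits_wronskian)
    show "\<forall>\<^sub>F x in at_left tm. wronskian u v x = k1"
      using eventually_at_left_real[OF order(1)] eventually_in_I(1) by eventually_elim (simp add: k1)
    show "\<forall>\<^sub>F x in at_right tm. wronskian u v x = k2"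
      using eventually_at_right_real[OF order(2)] eventually_in_I(2) by eventually_elim (simp add: k2)
  qed (use u v in \<open>simp_all add: transmission_def\<close>)
  moreover have "k3 = of_real (D2 P) * k2"
    unfolding D2_def
  proof (rule transmits_wronskian)
    show "\<forall>\<^sub>F x in at_left tp. wronskian u v x = k2"
      using eventually_at_left_real[OF order(2)] eventually_in_I(3) by eventually_elim (simp add: k2)
    show "\<forall>\<^sub>F x in at_right tp. wronskian u v x = k3"
      using eventually_at_right_real[OF order(3)] eventually_in_I(4) by eventually_elim (simp add: k3)
  qed (use u v in \<open>simp_all add: transmission_def\<close>)
  moreover have "x \<in> {a..tm} \<or> x \<in> {tm<..tp} \<or> x \<in> {tp<..b}" using x by (auto simp: I_eq)
  ultimately show ?thesis
    using k1[of x] k2[of x] k3[of x] x D_pos order by (auto simp: wt_def k1_omega)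
qed

lemma omega_at_b:
  assumes u: "solves P lam u" "transmission P u" and v: "solves P lam v" "transmission P v"
  shows "wronskian u v b = of_real (D1 P * D2 P) * omega P u v"
  using wt_wronskian[OF assms end_points_in_I(2)] D_pos order by (auto simp: wt_def field_simps)

section \<open>The operator on representatives\<close>

text \<open>The set where the functions differ is relatively open in \<open>I\<close>; if nonempty,
  it contains a nonempty open set and is no null set.\<close>

lemma continuous_AE_eq_imp_eq:
  assumes u: "continuous_on I u" and v: "continuous_on I v"
    and ae: "AE x in lebesgue_on {a..b}. u x = v x" and x: "x \<in> I"
  shows "u x = (v x :: complex)"
proof (rule ccontr)
  assume "u x \<noteq> v x"
  have "continuous_on I (\<lambda>y. u y - v y)" by (intro continuous_on_diff u v)
  then obtain U where U: "open U" "U \<inter> I = (\<lambda>y. u y - v y) -` (- {0}) \<inter> I"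
    unfolding continuous_on_open_invariant by (metis open_Compl closed_singleton)
  obtain c d where pc: "piece c d" "x \<in> {c..d}" using I_in_piece[OF x] .
  have "x \<in> U" using U(2) \<open>u x \<noteq> v x\<close> x by auto
  \<comment> \<open>The point may be \<open>a\<close> or \<open>b\<close>, so it is only known to
    lie in the closure of an open piece.\<close>
  moreover have "x \<in> closure {c<..<d}" using pc piece_order[OF pc(1)] by simp
  ultimately have "U \<inter> {c<..<d} \<noteq> {}"
    using open_Int_closure_eq_empty[OF U(1), of "{c<..<d}"] by blast
  then have "\<not> negligible (U \<inter> {c<..<d})"
    using U(1) by (intro open_not_negligible) auto
  moreover have "U \<inter> {c<..<d} \<subseteq> {y \<in> {a..b}. u y \<noteq> v y}"
    using U(2) piece_subset_I[OF pc(1)] by (fastforce simp: I_eq)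
  ultimately show False
    using ae negligible_subset unfolding AE_iff_negligible by blast
qed

lemma dom_funs_L2: "u \<in> dom_funs P \<Longrightarrow> u \<in> L2 P" "u \<in> dom_funs P \<Longrightarrow> tau P u \<in> L2 P"
  by (simp_all add: dom_funs_def)

lemma dom_funs_has_derivative:
  "u \<in> dom_funs P \<Longrightarrow> x \<in> I \<Longrightarrow> (u has_vector_derivative der P u x) (at x within I)"
  by (rule der_works) (simp add: dom_funs_def)

lemma dom_funs_cls_eq_imp_eq:
  assumes "u \<in> dom_funs P" "v \<in> dom_funs P" "cls P u = cls P v" "x \<in> I"
  shows "u x = v x"
proof (rule continuous_AE_eq_imp_eq[OF _ _ _ assms(4)])
  show "continuous_on I u" "continuous_on I v"
    using assms dom_funs_has_derivative by (blast intro: has_vector_derivative_imp_continuous_on_I)+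
  show "AE x in lebesgue_on {a..b}. u x = v x"
    using assms cls_eq_iff dom_funs_L2 by blast
qed

text \<open>The choice made by \<open>dom_rep\<close> does not matter: domain functions of one class
  agree on \<open>I\<close>, and \<open>tau\<close> on \<open>I\<close> and \<open>R_form\<close>
  depend on the values there alone.\<close>

lemma op_A_cls:
  assumes u: "u \<in> dom_funs P"
  shows "op_A P (cls P u, r) = (cls P (tau P u), - R_form P u)"
proof -
  define g where "g = dom_rep P (cls P u, r)"
  have "\<exists>f. f \<in> dom_funs P \<and> cls P f = fst (cls P u, r)" using u by auto
  then have g: "g \<in> dom_funs P" "cls P g = cls P u"
    unfolding g_def dom_rep_def by (metis (mono_tags, lifting) someI_ex fst_conv)+
  have eq: "g x = u x" if "x \<in> I" for x
    using dom_funs_cls_eq_imp_eq[OF g(1) u g(2) that] .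
  have "cls P (tau P g) = cls P (tau P u)"
    by (intro cls_cong_AE dom_funs_L2 g AE_I tau_cong eq)
  then show ?thesis
    using R_form_cong(1)[of g u] eq by (simp add: op_A_def flip: g_def)
qed

lemma lam_minus_A_cls:
  assumes u: "u \<in> dom_funs P"
  shows "lam_minus_A P lam (cls P u, R'_form P u) =
    (cls P (\<lambda>x. lam * u x - tau P u x), lam * R'_form P u + R_form P u)"
  using dom_funs_L2[OF u]
  by (simp add: lam_minus_A_def op_A_cls[OF u] H_scale_cls H_minus_cls L2_cmult)

text \<open>The conditions put the pair into the kernel of \<open>lam - A\<close>. It serves twice:
  for \<open>phi\<close>, to exclude \<open>omega = 0\<close>, and for a difference of two
  preimages, to get injectivity.\<close>

lemma AE_eq_0_if_not_eigenvalue: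
  assumes ev: "\<not> eigenvalue_A P lam" and u: "u \<in> dom_funs P"
    and tau: "AE x in lebesgue_on {a..b}. tau P u x = lam * u x"
    and R: "lam * R'_form P u + R_form P u = 0"
  shows "AE x in lebesgue_on {a..b}. u x = 0"
proof -
  let ?U = "(cls P u, R'_form P u)"
  have "?U \<in> dom_A P" using u by (auto simp: dom_A_def)
  moreover have "- R_form P u = lam * R'_form P u"
    using R by (metis add.commute minus_unique)
  then have "op_A P ?U = H_scale P lam ?U"
    using cls_cong_AE[OF dom_funs_L2(2)[OF u] tau]
    by (simp add: op_A_cls[OF u] H_scale_cls[OF dom_funs_L2(1)[OF u]])
  ultimately have "?U = H_zero P" using ev by (auto simp: eigenvalue_A_def)
  then have "cls P u = cls P (\<lambda>x. 0)" by (simp add: H_zero_def)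
  then show ?thesis using cls_eq_iff[OF dom_funs_L2(1)[OF u] const_L2] by simp
qed

section \<open>Differences of domain functions\<close>

lemma der_diff:
  assumes "u differentiable (at x within I)" "v differentiable (at x within I)" "x \<in> I"
  shows "der P (\<lambda>x. u x - v x) x = der P u x - der P v x"
  using assms by (intro der_eqI has_vector_derivative_diff der_works)

lemma transmits_diff:
  assumes u: "transmits P t m1 m2 m1' m2' u" and v: "transmits P t m1 m2 m1' m2' v"
    and l: "eventually (\<lambda>x. der P (\<lambda>x. u x - v x) x = der P u x - der P v x) (at_left t)"
    and r: "eventually (\<lambda>x. der P (\<lambda>x. u x - v x) x = der P u x - der P v x) (at_right t)"
  shows "transmits P t m1 m2 m1' m2' (\<lambda>x. u x - v x)"
proof -
  obtain ul ul' ur ur' where U: "(u \<longlongrightarrow> ul) (at_left t)" "(der P u \<longlongrightarrow> ul') (at_left t)"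
    "(u \<longlongrightarrow> ur) (at_right t)" "(der P u \<longlongrightarrow> ur') (at_right t)"
    "ur = of_real m1 * ul + of_real m2 * ul'" "ur' = of_real m1' * ul + of_real m2' * ul'"
    using u unfolding transmits_def by blast
  obtain vl vl' vr vr' where V: "(v \<longlongrightarrow> vl) (at_left t)" "(der P v \<longlongrightarrow> vl') (at_left t)"
    "(v \<longlongrightarrow> vr) (at_right t)" "(der P v \<longlongrightarrow> vr') (at_right t)"
    "vr = of_real m1 * vl + of_real m2 * vl'" "vr' = of_real m1' * vl + of_real m2' * vl'"
    using v unfolding transmits_def by blast
  show ?thesis
    unfolding transmits_def
  proof (intro exI conjI)
    show "((\<lambda>x. u x - v x) \<longlongrightarrow> ul - vl) (at_left t)" "((\<lambda>x. u x - v x) \<longlongrightarrow> ur - vr) (at_right t)"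
      by (intro tendsto_diff U V)+
    show "(der P (\<lambda>x. u x - v x) \<longlongrightarrow> ul' - vl') (at_left t)"
      using tendsto_diff[OF U(2) V(2)] by (simp add: tendsto_cong[OF l])
    show "(der P (\<lambda>x. u x - v x) \<longlongrightarrow> ur' - vr') (at_right t)"
      using tendsto_diff[OF U(4) V(4)] by (simp add: tendsto_cong[OF r])
  qed (simp_all add: U V algebra_simps)
qed

text \<open>The second derivatives are available only almost everywhere, so \<open>tau\<close>
  respects the difference only there; classes see no more than that.\<close>

lemma dom_funs_diff:
  assumes u: "u \<in> dom_funs P" and v: "v \<in> dom_funs P"
  defines "w \<equiv> \<lambda>x. u x - v x"
  shows "w \<in> dom_funs P" "AE x in lebesgue_on {a..b}. tau P w x = tau P u x - tau P v x"
    "R_form P w = R_form P u - R_form P v" "R'_form P w = R'_form P u - R'_form P v"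
proof -
  have du: "u differentiable (at x within I)" and dv: "v differentiable (at x within I)" if "x \<in> I" for x
    using u v that by (auto simp: dom_funs_def)
  have der_w: "der P w x = der P u x - der P v x" if "x \<in> I" for x
    unfolding w_def by (rule der_diff[OF du dv]) fact+
  have "AE x in lebesgue_on {a..b}. der P u differentiable (at x within I)"
    "AE x in lebesgue_on {a..b}. der P v differentiable (at x within I)"
    using u v by (auto simp: dom_funs_def)
  moreover have "AE x in lebesgue_on {a..b}. x \<in> I" by (rule AE_I)
  \<comment> \<open>Recording the derivative itself serves both the identity for \<open>tau\<close>
    and the differentiability demanded by \<open>dom_funs\<close>.\<close>
  ultimately have ae: "AE x in lebesgue_on {a..b}.
      (der P w has_vector_derivative der P (der P u) x - der P (der P v) x) (at x within I) \<and> x \<in> I"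
  proof eventually_elim
    fix x assume *: "der P u differentiable (at x within I)" "der P v differentiable (at x within I)" "x \<in> I"
    then have "((\<lambda>x. der P u x - der P v x) has_vector_derivative der P (der P u) x - der P (der P v) x)
        (at x within I)"
      by (intro has_vector_derivative_diff der_works)
    with *(3) show "(der P w has_vector_derivative der P (der P u) x - der P (der P v) x) (at x within I) \<and> x \<in> I"
      using has_vector_derivative_cong_I[of "der P w" "\<lambda>x. der P u x - der P v x" x] der_w by simp
  qed
  from ae show tau: "AE x in lebesgue_on {a..b}. tau P w x = tau P u x - tau P v x"
    by eventually_elim (auto simp: tau_def w_def algebra_simps dest!: der_eqI)
  show R: "R_form P w = R_form P u - R_form P v" "R'_form P w = R'_form P u - R'_form P v"
    unfolding R_form_def R'_form_def der_w[OF end_points_in_I(2)] by (simp_all add: w_def algebra_simps)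
  show "w \<in> dom_funs P"
    unfolding dom_funs_def
  proof (intro CollectI conjI ballI)
    show "w \<in> L2 P" unfolding w_def by (intro L2_diff dom_funs_L2 u v)
    show "w differentiable (at x within I)" if "x \<in> I" for x
      unfolding w_def using du[OF that] dv[OF that] by simp
    show "AE x in lebesgue_on {a..b}. der P w differentiable (at x within I)"
      using ae by eventually_elim (blast intro: differentiableI_vector)
    have "AE x in lebesgue_on {a..b}. tau P u x - tau P v x = tau P w x"
      using tau by eventually_elim simp
    then show "tau P w \<in> L2 P"
      by (rule L2_cong_AE[OF L2_diff[OF dom_funs_L2(2)[OF u] dom_funs_L2(2)[OF v]]])
    have "of_real (beta1 P) * u a + of_real (beta2 P) * der P u a = 0"
      "of_real (beta1 P) * v a + of_real (beta2 P) * der P v a = 0"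
      using u v by (auto simp: dom_funs_def)
    moreover have "of_real (beta1 P) * w a + of_real (beta2 P) * der P w a =
        (of_real (beta1 P) * u a + of_real (beta2 P) * der P u a) -
        (of_real (beta1 P) * v a + of_real (beta2 P) * der P v a)"
      unfolding der_w[OF end_points_in_I(1)] by (simp add: w_def algebra_simps)
    ultimately show "of_real (beta1 P) * w a + of_real (beta2 P) * der P w a = 0" by simp
    have "transmission P u" "transmission P v" using u v by (auto simp: dom_funs_def)
    moreover have ev: "eventually (\<lambda>x. x \<in> I) F \<Longrightarrow>
        eventually (\<lambda>x. der P (\<lambda>x. u x - v x) x = der P u x - der P v x) F" for F
      by (elim eventually_mono) (use der_w in \<open>simp add: w_def\<close>)
    ultimately show "transmission P w"
      using eventually_in_I[THEN ev] unfolding transmission_def w_def by (blast intro: transmits_diff)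
    fix J assume J: "J \<in> {I1 P, I2 P, I3 P}"
    then have "piece_abs_cont P J u" "piece_abs_cont P J v"
      "piece_abs_cont P J (der P u)" "piece_abs_cont P J (der P v)"
      using u v by (auto simp: dom_funs_def)
    moreover have "piece_abs_cont P J (\<lambda>x. g x - h x)"
      if "piece_abs_cont P J g" "piece_abs_cont P J h" for g h
      using that abs_cont_on_diff unfolding piece_abs_cont_def by fastforce
    moreover have "piece_abs_cont P J (der P w) \<longleftrightarrow> piece_abs_cont P J (\<lambda>x. der P u x - der P v x)"
      unfolding piece_abs_cont_def using der_w by simp
    ultimately show "piece_abs_cont P J w" "piece_abs_cont P J (der P w)"
      unfolding w_def by auto
  qed
qed

section \<open>Homogeneous solutions in the domain, and the nonvanishing of
  \<open>omega\<close>\<close>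

lemma piece_intervals:
  assumes "J \<in> {I1 P, I2 P, I3 P}"
  obtains c d where "piece c d" "J = {c..d}"
  using assms that piece_simps unfolding I1_def I2_def I3_def by blast

lemma solution_in_dom_funs:
  assumes w: "solves P lam w" "transmission P w"
    and bc: "of_real (beta1 P) * w a + of_real (beta2 P) * der P w a = 0"
  shows "w \<in> dom_funs P"
  unfolding dom_funs_def
proof (intro CollectI conjI ballI)
  have L2w: "w \<in> L2 P" by (rule regular_imp_L2[OF solution_regular(1)[OF w]])
  then show "w \<in> L2 P" .
  show "w differentiable (at x within I)" if "x \<in> I" for x
    using w that by (simp add: solves_def)
  show "AE x in lebesgue_on {a..b}. der P w differentiable (at x within I)"
    using w by (intro AE_I) (simp add: solves_def)
  have "AE x in lebesgue_on {a..b}. lam * w x = tau P w x"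
    using w by (intro AE_I) (simp add: solves_def)
  then show "tau P w \<in> L2 P" by (rule L2_cong_AE[OF L2_cmult[OF L2w]])
  fix J assume "J \<in> {I1 P, I2 P, I3 P}"
  then obtain c d where J: "piece c d" "J = {c..d}" by (rule piece_intervals)
  obtain L h h' where "L-lipschitz_on {c..d} h" "\<And>x. x \<in> {c..d} \<inter> I \<Longrightarrow> h x = w x"
    "L-lipschitz_on {c..d} h'" "\<And>x. x \<in> {c..d} \<inter> I \<Longrightarrow> h' x = der P w x"
    using solution_lipschitz[OF w J(1)] by blast
  then show "piece_abs_cont P J w" "piece_abs_cont P J (der P w)"
    using lipschitz_imp_abs_cont_on unfolding piece_abs_cont_def J by blast+
qed (use w bc in simp_all)

text \<open>The data of \<open>chi\<close> at \<open>b\<close> are the coefficients of the boundary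
  form, so pairing any function with \<open>chi\<close> there evaluates the form. It is used for
  \<open>phi\<close> and for \<open>chi\<close> itself.\<close>

lemma wronskian_at_b:
  assumes "is_chi P lam chi"
  shows "wronskian phi chi b = lam * R'_form P phi + R_form P phi"
  using assms by (simp add: is_chi_def wronskian_def R_form_def R'_form_def algebra_simps)

lemma omega_neq_0:
  assumes phi: "is_phi P lam phi" and chi: "is_chi P lam chi" and ev: "\<not> eigenvalue_A P lam"
  shows "omega P phi chi \<noteq> 0"
proof
  assume "omega P phi chi = 0"
  then have R: "lam * R'_form P phi + R_form P phi = 0"
    using omega_at_b[of lam phi chi] wronskian_at_b[OF chi] phi chi by (simp add: is_phi_def is_chi_def)
  have dom: "phi \<in> dom_funs P"
    using phi by (intro solution_in_dom_funs[of lam]) (auto simp: is_phi_def)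
  have "AE x in lebesgue_on {a..b}. tau P phi x = lam * phi x"
    using phi by (intro AE_I) (simp add: is_phi_def solves_def)
  from AE_eq_0_if_not_eigenvalue[OF ev dom this R]
  have ae0: "AE x in lebesgue_on {a..b}. phi x = 0" .
  have zero: "phi x = 0" if "x \<in> I" for x
    using continuous_AE_eq_imp_eq[OF _ _ ae0 that] dom_funs_has_derivative[OF dom]
      has_vector_derivative_imp_continuous_on_I by (metis continuous_on_const)
  \<comment> \<open>As \<open>lam\<close> is no eigenvalue, \<open>phi\<close> would vanish on
    \<open>I\<close>, and with it the initial data \<open>beta2\<close> and \<open>- beta1\<close>,
    which are not both zero.\<close>
  have "der P phi a = der P (\<lambda>x. 0) a"
    by (intro der_cong zero end_points_in_I(1))
  also have "\<dots> = 0"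
    by (rule der_eqI[OF has_vector_derivative_const end_points_in_I(1)])
  finally have "der P phi a = 0" .
  then have "beta1 P = 0" "beta2 P = 0"
    using zero[OF end_points_in_I(1)] phi by (auto simp: is_phi_def)
  then show False using SL by (simp add: SL_problem_def)
qed

section \<open>The weight and weighted integrals\<close>

lemma wt_measurable: "wt \<in> borel_measurable (lebesgue_on {a..b})"
proof -
  have "wt \<in> borel_measurable borel" unfolding wt_def by measurable
  then show ?thesis by (intro measurable_restrict_space1 measurable_completion) simp
qed

lemma wt_bounded: "cmod (wt x) \<le> 1 + 1 / D1 P + 1 / (D1 P * D2 P)"
  using D_pos by (simp add: wt_def norm_divide norm_mult)

lemma wt_L2: "g \<in> L2 P \<Longrightarrow> (\<lambda>x. wt x * g x) \<in> L2 P"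
  by (rule bounded_mult_L2[OF wt_measurable wt_bounded])

lemma regular_mult_L2: "regular g \<Longrightarrow> h \<in> L2 P \<Longrightarrow> (\<lambda>x. g x * h x) \<in> L2 P"
  by (metis regular_bounded regular_measurable bounded_mult_L2)

lemma L2_HK_integrable: "g \<in> L2 P \<Longrightarrow> g integrable_on {a..b}"
  using L2_integrable_on(1) set_lebesgue_integral_eq_integral(1) by blast

text \<open>The middle and right pieces disagree with the weight at their left end point only.\<close>

lemma weighted_integral_split:
  assumes g: "g \<in> L2 P"
  shows "(LINT y|lebesgue_on (I1 P). g y) + of_real (1 / D1 P) * (LINT y|lebesgue_on (I2 P). g y) +
      of_real (1 / (D1 P * D2 P)) * (LINT y|lebesgue_on (I3 P). g y) = integral {a..b} (\<lambda>y. wt y * g y)"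
proof -
  have piece_int: "k * (LINT y|lebesgue_on {c..d}. g y) = integral {c..d} (\<lambda>y. wt y * g y)"
    if cd: "piece c d" and k: "\<And>y. y \<in> {c<..d} \<Longrightarrow> wt y = k" for c d k
  proof -
    have "g absolutely_integrable_on {c..d}"
      using piece_order[OF cd] by (intro absolutely_integrable_on_subinterval[OF L2_integrable_on(1)[OF g]]) auto
    then have "integrable (lebesgue_on {c..d}) g"
      by (simp add: set_integrable_def integrable_restrict_space)
    then have "(LINT y|lebesgue_on {c..d}. g y) = integral {c..d} g"
      by (rule lebesgue_integral_eq_integral) simp
    moreover have "integral {c..d} (\<lambda>y. wt y * g y) = integral {c..d} (\<lambda>y. k * g y)"
      by (rule integral_spike[of "{c}"]) (use k in auto)
    ultimately show ?thesis by simp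
  qed
  let ?w = "\<lambda>y. wt y * g y"
  have int: "?w integrable_on {a..b}" by (rule L2_HK_integrable[OF wt_L2[OF g]])
  have "integral {a..tm} ?w + integral {tm..tp} ?w = integral {a..tp} ?w"
    using order by (intro Henstock_Kurzweil_Integration.integral_combine integrable_subinterval_real[OF int]) auto
  moreover have "integral {a..tp} ?w + integral {tp..b} ?w = integral {a..b} ?w"
    using order by (intro Henstock_Kurzweil_Integration.integral_combine int) auto
  moreover have "1 * (LINT y|lebesgue_on {a..tm}. g y) = integral {a..tm} ?w"
    by (rule piece_int) (auto simp: wt_def)
  moreover have "of_real (1 / D1 P) * (LINT y|lebesgue_on {tm..tp}. g y) = integral {tm..tp} ?w"
    by (rule piece_int) (auto simp: wt_def)
  moreover have "of_real (1 / (D1 P * D2 P)) * (LINT y|lebesgue_on {tp..b}. g y) = integral {tp..b} ?w"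
    by (rule piece_int) (use order in \<open>auto simp: wt_def\<close>)
  ultimately show ?thesis by (simp only: I1_def I2_def I3_def mult_1_left)
qed

end

section \<open>Variation of parameters\<close>

locale SL_resolvent = SL_transmission +
  fixes lam f1 :: complex and phi chi f :: "real \<Rightarrow> complex"
  assumes phi: "is_phi P lam phi" and chi: "is_chi P lam chi"
    and omega: "omega P phi chi \<noteq> 0" and f: "f \<in> L2 P"
begin

text \<open>Normalised so that on \<open>I\<close> the Wronskian of \<open>phi\<close> and
  \<open>chi\<close> times \<open>F\<close> is \<open>f\<close>; the weight and \<open>omega\<close>
  then drop out of the calculus.\<close>

definition F where "F t = wt t * f t / omega P phi chi"

definition coef_chi where "coef_chi x = integral {a..x} (\<lambda>t. phi t * F t)"

text \<open>The integral over \<open>{x..b}\<close> is written as a difference, so that both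
  coefficients are built from indefinite integrals starting at \<open>a\<close>.\<close>

definition coef_phi where "coef_phi x = f1 / (of_real (D1 P * D2 P) * omega P phi chi) +
  integral {a..b} (\<lambda>t. chi t * F t) - integral {a..x} (\<lambda>t. chi t * F t)"

definition sol where "sol x = chi x * coef_chi x + phi x * coef_phi x"

text \<open>The formal product rule also produces \<open>chi * (phi * F)\<close> and
  \<open>- phi * (chi * F)\<close> from the coefficients; these cancel.\<close>

definition sol' where "sol' x = der P chi x * coef_chi x + der P phi x * coef_phi x"

lemma phi_sol: "solves P lam phi" "transmission P phi"
  and chi_sol: "solves P lam chi" "transmission P chi"
  using phi chi by (simp_all add: is_phi_def is_chi_def)

lemma regular_phi: "regular phi" and regular_chi: "regular chi"
  using solution_regular(1) phi_sol chi_sol by blast+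

lemma F_L2: "F \<in> L2 P"
  using L2_cmult[OF wt_L2[OF f], of "1 / omega P phi chi"] by (simp add: F_def[abs_def])

lemma phi_F_L2: "(\<lambda>t. phi t * F t) \<in> L2 P" and chi_F_L2: "(\<lambda>t. chi t * F t) \<in> L2 P"
  by (intro regular_mult_L2 regular_phi regular_chi F_L2)+

lemma continuous_on_coef: "continuous_on {a..b} coef_chi" "continuous_on {a..b} coef_phi"
  unfolding coef_chi_def coef_phi_def
  by (intro continuous_intros indefinite_integral_continuous_1 L2_HK_integrable phi_F_L2 chi_F_L2)+

lemma abs_cont_on_coef: "abs_cont_on {a..b} coef_chi" "abs_cont_on {a..b} coef_phi"
  unfolding coef_chi_def coef_phi_def
  by (intro abs_cont_on_diff abs_cont_on_const abs_cont_on_integral L2_HK_integrable L2_integrable_on(2)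
      phi_F_L2 chi_F_L2)+

lemma sol_has_derivative:
  assumes x: "x \<in> I"
  shows "(sol has_vector_derivative sol' x) (at x within I)"
proof -
  have xab: "x \<in> {a..b}" using x by (simp add: I_eq)
  \<comment> \<open>The kernel of \<open>chi x * coef_chi y + phi x * coef_phi y\<close>, the part
    of \<open>sol y\<close> whose solution factors are frozen at \<open>x\<close>.\<close>
  define k where "k = (\<lambda>t. chi x * phi t - phi x * chi t)"
  have dphi: "(phi has_vector_derivative der P phi x) (at x within {a..b})"
    and dchi: "(chi has_vector_derivative der P chi x) (at x within {a..b})"
    using solves_has_derivatives(1)[OF phi_sol(1) x] solves_has_derivatives(1)[OF chi_sol(1) x] at_within_I[OF x]
    by simp_all
  have coef: "(coef_chi \<longlongrightarrow> coef_chi x) (at x within {a..b})" "(coef_phi \<longlongrightarrow> coef_phi x) (at x within {a..b})"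
    using continuous_on_coef xab by (simp_all add: continuous_on_def)
  have chi_part: "((\<lambda>y. (chi y - chi x) * coef_chi y) has_vector_derivative der P chi x * coef_chi x) (at x within {a..b})"
    using has_vector_derivative_diff[OF dchi has_vector_derivative_const[of "chi x"]]
    by (intro has_vector_derivative_mult_vanishing coef) simp_all
  have phi_part: "((\<lambda>y. (phi y - phi x) * coef_phi y) has_vector_derivative der P phi x * coef_phi x) (at x within {a..b})"
    using has_vector_derivative_diff[OF dphi has_vector_derivative_const[of "phi x"]]
    by (intro has_vector_derivative_mult_vanishing coef) simp_all
  have kF: "(\<lambda>t. k t * F t) = (\<lambda>t. chi x * (phi t * F t) - phi x * (chi t * F t))"
    by (simp add: k_def algebra_simps)
  have int: "(\<lambda>t. phi t * F t) integrable_on {a..y}" "(\<lambda>t. chi t * F t) integrable_on {a..y}" if "y \<in> {a..b}" for y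
    using that by (auto intro!: integrable_subinterval_real[OF L2_HK_integrable[OF phi_F_L2]]
        integrable_subinterval_real[OF L2_HK_integrable[OF chi_F_L2]])
  have vanish: "((\<lambda>y. integral {a..y} (\<lambda>t. k t * F t)) has_vector_derivative 0) (at x within {a..b})"
  proof (rule has_vector_derivative_integral_vanishing[OF xab L2_integrable_on(1)[OF F_L2]])
    show "(\<lambda>t. k t * F t) integrable_on {a..b}"
      unfolding kF using order int[of b] by (intro integrable_diff integrable_on_mult_right) auto
    show "(k has_vector_derivative chi x * der P phi x - phi x * der P chi x) (at x within {a..b})"
      unfolding k_def by (intro has_vector_derivative_diff has_vector_derivative_mult_right dphi dchi)
  qed (simp add: k_def)
  define e where "e = f1 / (of_real (D1 P * D2 P) * omega P phi chi) + integral {a..b} (\<lambda>t. chi t * F t)"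
  have coef_phi: "coef_phi z = e - integral {a..z} (\<lambda>t. chi t * F t)" for z
    by (simp only: coef_phi_def e_def)
  define c where "c = phi x * e"
  \<comment> \<open>Two terms pair a factor vanishing at \<open>x\<close> with a merely continuous
    coefficient; the third, frozen part is a constant plus the integral of \<open>k * F\<close>.
    Each term is differentiable at \<open>x\<close> without any differentiability of the
    coefficients.\<close>
  have split: "sol y = (chi y - chi x) * coef_chi y + (phi y - phi x) * coef_phi y +
      (c + integral {a..y} (\<lambda>t. k t * F t))" if "y \<in> {a..b}" for y
  proof -
    have "integral {a..y} (\<lambda>t. k t * F t) =
        chi x * integral {a..y} (\<lambda>t. phi t * F t) - phi x * integral {a..y} (\<lambda>t. chi t * F t)"
      unfolding kF using int[OF that] by (subst integral_diff) (auto intro: integrable_on_mult_right)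
    then show ?thesis by (simp add: sol_def coef_chi_def coef_phi c_def algebra_simps)
  qed
  have "((\<lambda>y. (chi y - chi x) * coef_chi y + (phi y - phi x) * coef_phi y +
      (c + integral {a..y} (\<lambda>t. k t * F t))) has_vector_derivative
      (der P chi x * coef_chi x + der P phi x * coef_phi x + (0 + 0))) (at x within {a..b})"
    by (intro has_vector_derivative_add chi_part phi_part has_vector_derivative_const vanish)
  then have "(sol has_vector_derivative sol' x) (at x within {a..b})"
    unfolding sol'_def
    using has_vector_derivative_transform[OF xab split] by simp
  then show ?thesis by (simp add: at_within_I[OF x])
qed

lemma der_sol: "x \<in> I \<Longrightarrow> der P sol x = sol' x"
  by (rule der_eqI[OF sol_has_derivative])

text \<open>At almost every point both coefficients are differentiable and the product rule applies
  literally. This time their derivatives do not cancel but combine to the Wronskian times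
  \<open>F\<close>.\<close>

lemma AE_sol'_has_derivative:
  "AE x in lebesgue_on {a..b}. x \<in> I \<and>
     (sol' has_vector_derivative (of_real (pot P x) - lam) * sol x + f x) (at x within I)"
proof -
  have L: "AE x in lebesgue_on {a..b}. x \<in> {a<..<b} \<longrightarrow>
      ((\<lambda>y. integral {a..y} g) has_vector_derivative g x) (at x)" if "g \<in> L2 P" for g
    unfolding AE_iff_negligible
    by (rule negligible_subset[OF negligible_not_has_vector_derivative_integral[OF L2_HK_integrable[OF that]]]) auto
  \<comment> \<open>Away from the end points the derivative within \<open>I\<close> is two-sided, as
    the differentiation theorem provides it.\<close>
  have "AE x in lebesgue_on {a..b}. x \<in> {a<..<b}"
    unfolding AE_iff_negligible by (rule negligible_subset[of "{a, b}"]) auto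
  moreover have "AE x in lebesgue_on {a..b}. x \<in> I" by (rule AE_I)
  ultimately show ?thesis
    using L[OF phi_F_L2] L[OF chi_F_L2]
  proof eventually_elim
    fix x assume ab: "x \<in> {a<..<b}" and x: "x \<in> I"
    assume A: "x \<in> {a<..<b} \<longrightarrow> ((\<lambda>y. integral {a..y} (\<lambda>t. phi t * F t)) has_vector_derivative phi x * F x) (at x)"
      and B: "x \<in> {a<..<b} \<longrightarrow> ((\<lambda>y. integral {a..y} (\<lambda>t. chi t * F t)) has_vector_derivative chi x * F x) (at x)"
    have at: "at x within I = at x" using ab by (intro at_within_I_interior[OF x]) auto
    have dA: "(coef_chi has_vector_derivative phi x * F x) (at x)"
      using A ab by (simp add: coef_chi_def[abs_def])
    have dB: "(coef_phi has_vector_derivative 0 - chi x * F x) (at x)"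
      unfolding coef_phi_def[abs_def] using B ab
      by (intro has_vector_derivative_diff has_vector_derivative_const) simp
    note d = solves_has_derivatives(2)[OF phi_sol(1) x, unfolded at] solves_has_derivatives(2)[OF chi_sol(1) x, unfolded at]
    have "(sol' has_vector_derivative
        (der P chi x * (phi x * F x) + (of_real (pot P x) - lam) * chi x * coef_chi x) +
        (der P phi x * (0 - chi x * F x) + (of_real (pot P x) - lam) * phi x * coef_phi x)) (at x)"
      unfolding sol'_def[abs_def] by (intro has_vector_derivative_add has_vector_derivative_mult d dA dB)
    moreover have "wronskian phi chi x * F x = f x"
      using wt_wronskian[OF phi_sol chi_sol x] omega by (simp add: F_def field_simps)
    then have "(der P chi x * (phi x * F x) + (of_real (pot P x) - lam) * chi x * coef_chi x) +
        (der P phi x * (0 - chi x * F x) + (of_real (pot P x) - lam) * phi x * coef_phi x) =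
        (of_real (pot P x) - lam) * sol x + f x"
      by (simp add: sol_def wronskian_def algebra_simps)
    ultimately show "x \<in> I \<and>
        (sol' has_vector_derivative (of_real (pot P x) - lam) * sol x + f x) (at x within I)"
      using x at by simp
  qed
qed

lemma AE_tau_sol: "AE x in lebesgue_on {a..b}. der P sol differentiable (at x within I) \<and>
    lam * sol x - tau P sol x = f x"
  using AE_sol'_has_derivative
proof eventually_elim
  fix x assume *: "x \<in> I \<and> (sol' has_vector_derivative (of_real (pot P x) - lam) * sol x + f x) (at x within I)"
  then have d: "(der P sol has_vector_derivative (of_real (pot P x) - lam) * sol x + f x) (at x within I)"
    using has_vector_derivative_cong_I[of "der P sol" sol' x] der_sol by simp
  then have "der P (der P sol) x = (of_real (pot P x) - lam) * sol x + f x"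
    using * by (intro der_eqI) auto
  with d show "der P sol differentiable (at x within I) \<and> lam * sol x - tau P sol x = f x"
    by (auto simp: tau_def algebra_simps intro: differentiableI_vector)
qed

lemma transmits_sol:
  assumes t: "t \<in> {a<..<b}" and u: "transmits P t m1 m2 m1' m2' phi" and v: "transmits P t m1 m2 m1' m2' chi"
    and l: "eventually (\<lambda>x. x \<in> I) (at_left t)" and r: "eventually (\<lambda>x. x \<in> I) (at_right t)"
  shows "transmits P t m1 m2 m1' m2' sol"
proof -
  obtain ul ul' ur ur' where U: "(phi \<longlongrightarrow> ul) (at_left t)" "(der P phi \<longlongrightarrow> ul') (at_left t)"
    "(phi \<longlongrightarrow> ur) (at_right t)" "(der P phi \<longlongrightarrow> ur') (at_right t)"
    "ur = of_real m1 * ul + of_real m2 * ul'" "ur' = of_real m1' * ul + of_real m2' * ul'"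
    using u unfolding transmits_def by blast
  obtain vl vl' vr vr' where V: "(chi \<longlongrightarrow> vl) (at_left t)" "(der P chi \<longlongrightarrow> vl') (at_left t)"
    "(chi \<longlongrightarrow> vr) (at_right t)" "(der P chi \<longlongrightarrow> vr') (at_right t)"
    "vr = of_real m1 * vl + of_real m2 * vl'" "vr' = of_real m1' * vl + of_real m2' * vl'"
    using v unfolding transmits_def by blast
  have c: "(coef_chi \<longlongrightarrow> coef_chi t) (at t)" "(coef_phi \<longlongrightarrow> coef_phi t) (at t)"
  proof -
    have "t \<in> {a..b}" and at: "at t within {a..b} = at t"
      using t by (auto simp: at_within_Icc_at)
    then show "(coef_chi \<longlongrightarrow> coef_chi t) (at t)" "(coef_phi \<longlongrightarrow> coef_phi t) (at t)"
      using continuous_on_coef[unfolded continuous_on_def] unfolding at[symmetric] by blast+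
  qed
  have cl: "(coef_chi \<longlongrightarrow> coef_chi t) (at_left t)" "(coef_phi \<longlongrightarrow> coef_phi t) (at_left t)"
    and cr: "(coef_chi \<longlongrightarrow> coef_chi t) (at_right t)" "(coef_phi \<longlongrightarrow> coef_phi t) (at_right t)"
    using c by (auto intro: tendsto_within_subset[where S = UNIV])
  have el: "\<forall>\<^sub>F x in at_left t. der P sol x = der P chi x * coef_chi x + der P phi x * coef_phi x"
    using l by eventually_elim (simp add: der_sol sol'_def)
  have er: "\<forall>\<^sub>F x in at_right t. der P sol x = der P chi x * coef_chi x + der P phi x * coef_phi x"
    using r by eventually_elim (simp add: der_sol sol'_def)
  show ?thesis
    unfolding transmits_def
  proof (intro exI conjI)
    show "(sol \<longlongrightarrow> vl * coef_chi t + ul * coef_phi t) (at_left t)"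
      "(sol \<longlongrightarrow> vr * coef_chi t + ur * coef_phi t) (at_right t)"
      unfolding sol_def[abs_def] by (intro tendsto_add tendsto_mult U V cl cr)+
    show "(der P sol \<longlongrightarrow> vl' * coef_chi t + ul' * coef_phi t) (at_left t)"
      unfolding tendsto_cong[OF el] by (intro tendsto_add tendsto_mult U V cl)
    show "(der P sol \<longlongrightarrow> vr' * coef_chi t + ur' * coef_phi t) (at_right t)"
      unfolding tendsto_cong[OF er] by (intro tendsto_add tendsto_mult U V cr)
  qed (simp_all add: U V algebra_simps)
qed

lemma transmission_sol: "transmission P sol"
  using phi_sol(2) chi_sol(2) order eventually_in_I unfolding transmission_def
  by (auto intro!: transmits_sol)

lemma coef_ends: "coef_chi a = 0" "coef_phi b = f1 / (of_real (D1 P * D2 P) * omega P phi chi)"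
  by (simp_all add: coef_chi_def coef_phi_def)

lemma R_sol: "lam * R'_form P sol + R_form P sol = f1"
proof -
  have "lam * R'_form P sol + R_form P sol =
      coef_chi b * (lam * R'_form P chi + R_form P chi) + coef_phi b * (lam * R'_form P phi + R_form P phi)"
    unfolding R_form_def R'_form_def der_sol[OF end_points_in_I(2)] by (simp add: sol_def sol'_def algebra_simps)
  \<comment> \<open>The Wronskian of \<open>chi\<close> with itself vanishes, so \<open>chi\<close>
    satisfies the homogeneous condition at \<open>b\<close>.\<close>
  also have "lam * R'_form P chi + R_form P chi = 0"
    using wronskian_at_b[OF chi, of chi] by (simp add: wronskian_def)
  also have "lam * R'_form P phi + R_form P phi = of_real (D1 P * D2 P) * omega P phi chi"
    using wronskian_at_b[OF chi, of phi] omega_at_b[OF phi_sol chi_sol] by simp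
  finally show ?thesis using omega D_pos by (simp add: coef_ends)
qed

text \<open>Applied with extensions of \<open>chi\<close> and \<open>phi\<close> it covers
  \<open>sol\<close>, and with extensions of their derivatives it covers
  \<open>der P sol\<close>.\<close>

lemma piece_abs_cont_combination:
  assumes pc: "piece c d" and g: "L-lipschitz_on {c..d} g" and h: "M-lipschitz_on {c..d} h"
    and eq: "\<And>x. x \<in> {c..d} \<inter> I \<Longrightarrow> g x * coef_chi x + h x * coef_phi x = k x"
  shows "piece_abs_cont P {c..d} k"
proof -
  have sub: "{c..d} \<subseteq> {a..b}" using piece_order[OF pc] by auto
  have "abs_cont_on {c..d} (\<lambda>x. g x * coef_chi x + h x * coef_phi x)"
    by (intro abs_cont_on_add abs_cont_on_mult_Icc lipschitz_imp_abs_cont_on[OF g] lipschitz_imp_abs_cont_on[OF h]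
        lipschitz_on_continuous_on[OF g] lipschitz_on_continuous_on[OF h]
        abs_cont_on_subset[OF abs_cont_on_coef(1) sub] abs_cont_on_subset[OF abs_cont_on_coef(2) sub]
        continuous_on_subset[OF continuous_on_coef(1) sub] continuous_on_subset[OF continuous_on_coef(2) sub])
  then show ?thesis unfolding piece_abs_cont_def using eq by blast
qed

lemma sol_in_dom_funs: "sol \<in> dom_funs P"
  unfolding dom_funs_def
proof (intro CollectI conjI ballI)
  have "regular sol"
    unfolding regular_def using transmission_limits[OF transmission_sol]
      has_vector_derivative_imp_continuous_on_I[OF sol_has_derivative] by blast
  then show L2: "sol \<in> L2 P" by (rule regular_imp_L2)
  show "sol differentiable (at x within I)" if "x \<in> I" for x
    using sol_has_derivative[OF that] by (rule differentiableI_vector)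
  show "AE x in lebesgue_on {a..b}. der P sol differentiable (at x within I)"
    using AE_tau_sol by eventually_elim simp
  \<comment> \<open>The equation itself expresses \<open>tau P sol\<close> by square integrable
    functions, so no second derivative has to be estimated.\<close>
  have "AE x in lebesgue_on {a..b}. lam * sol x - f x = tau P sol x"
    using AE_tau_sol by eventually_elim (simp add: algebra_simps)
  then show "tau P sol \<in> L2 P" by (rule L2_cong_AE[OF L2_diff[OF L2_cmult[OF L2] f]])
  show "of_real (beta1 P) * sol a + of_real (beta2 P) * der P sol a = 0"
    \<comment> \<open>Since \<open>coef_chi a = 0\<close>, value and derivative of
      \<open>sol\<close> at \<open>a\<close> are those of \<open>phi\<close> times
      \<open>coef_phi a\<close>.\<close>
    unfolding der_sol[OF end_points_in_I(1)] using phi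
    by (simp add: sol_def sol'_def coef_ends is_phi_def)
  show "transmission P sol" by (rule transmission_sol)
  fix J assume "J \<in> {I1 P, I2 P, I3 P}"
  then obtain c d where J: "piece c d" "J = {c..d}" by (rule piece_intervals)
  obtain L h h' where h: "L-lipschitz_on {c..d} h" "\<And>x. x \<in> {c..d} \<inter> I \<Longrightarrow> h x = phi x"
    "L-lipschitz_on {c..d} h'" "\<And>x. x \<in> {c..d} \<inter> I \<Longrightarrow> h' x = der P phi x"
    using solution_lipschitz[OF phi_sol J(1)] by blast
  obtain M g g' where g: "M-lipschitz_on {c..d} g" "\<And>x. x \<in> {c..d} \<inter> I \<Longrightarrow> g x = chi x"
    "M-lipschitz_on {c..d} g'" "\<And>x. x \<in> {c..d} \<inter> I \<Longrightarrow> g' x = der P chi x"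
    using solution_lipschitz[OF chi_sol J(1)] by blast
  show "piece_abs_cont P J sol"
    unfolding J(2) by (rule piece_abs_cont_combination[OF J(1) g(1) h(1)]) (simp add: g h sol_def)
  show "piece_abs_cont P J (der P sol)"
    unfolding J(2) by (rule piece_abs_cont_combination[OF J(1) g(3) h(3)]) (simp add: g h der_sol sol'_def)
qed

lemma lam_minus_A_sol: "lam_minus_A P lam (cls P sol, R'_form P sol) = (cls P f, f1)"
proof -
  have "AE x in lebesgue_on {a..b}. lam * sol x - tau P sol x = f x"
    using AE_tau_sol by eventually_elim simp
  then have "cls P (\<lambda>x. lam * sol x - tau P sol x) = cls P f"
    using dom_funs_L2[OF sol_in_dom_funs] by (intro cls_cong_AE L2_diff L2_cmult)
  then show ?thesis by (simp add: lam_minus_A_cls[OF sol_in_dom_funs] R_sol)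
qed

section \<open>The representation by the Green's function\<close>

lemma green_f_L2: "(\<lambda>y. green P phi chi x y * f y) \<in> L2 P"
proof -
  obtain B1 where B1: "B1 > 0" "\<And>x. x \<in> {a..b} \<Longrightarrow> cmod (phi x) \<le> B1"
    using regular_bounded[OF regular_phi] by blast
  obtain B2 where B2: "B2 > 0" "\<And>x. x \<in> {a..b} \<Longrightarrow> cmod (chi x) \<le> B2"
    using regular_bounded[OF regular_chi] by blast
  have ind: "indicat_real {..x} \<in> borel_measurable (lebesgue_on {a..b})"
    by (intro measurable_restrict_space1 measurable_completion) simp
  \<comment> \<open>Writing the case distinction with the indicator of \<open>{..x}\<close> reduces
    measurability in \<open>y\<close> to that of \<open>phi\<close> and \<open>chi\<close>.\<close>
  have "green P phi chi x = (\<lambda>y. of_real (indicat_real {..x} y) * (phi y * chi x / omega P phi chi) +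
      of_real (1 - indicat_real {..x} y) * (phi x * chi y / omega P phi chi))"
    by (auto simp: green_def fun_eq_iff indicator_def)
  also have "\<dots> \<in> borel_measurable (lebesgue_on {a..b})"
    using ind regular_measurable[OF regular_phi] regular_measurable[OF regular_chi]
    by measurable
  finally have meas: "green P phi chi x \<in> borel_measurable (lebesgue_on {a..b})" .
  define B where "B = (B1 * cmod (chi x) + cmod (phi x) * B2) / cmod (omega P phi chi)"
  have "cmod (green P phi chi x y) \<le> B" if y: "y \<in> {a..b}" for y
  proof -
    have "cmod (phi y * chi x) \<le> B1 * cmod (chi x)" "cmod (phi x * chi y) \<le> cmod (phi x) * B2"
      "0 \<le> B1 * cmod (chi x)" "0 \<le> cmod (phi x) * B2"
      using B1 B2 y by (auto simp: norm_mult intro: mult_right_mono mult_left_mono)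
    then show ?thesis
      by (auto simp: green_def B_def norm_divide intro!: divide_right_mono)
  qed
  then show ?thesis by (rule bounded_mult_L2[OF meas _ f])
qed

text \<open>Cutting the integral at \<open>x\<close> selects one branch of \<open>green\<close> on
  each side. The left part is \<open>chi x * coef_chi x\<close>, the right part is
  \<open>phi x * coef_phi x\<close> up to the constant that carries \<open>f1\<close>.\<close>

lemma sol_eq_green:
  assumes x: "x \<in> I"
  shows "sol x = (LINT y|lebesgue_on (I1 P). green P phi chi x y * f y) +
          of_real (1 / D1 P) * (LINT y|lebesgue_on (I2 P). green P phi chi x y * f y) +
          of_real (1 / (D1 P * D2 P)) * (LINT y|lebesgue_on (I3 P). green P phi chi x y * f y) +
          f1 * phi x / (of_real (D1 P * D2 P) * omega P phi chi)"
proof -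
  let ?G = "\<lambda>y. wt y * (green P phi chi x y * f y)"
  have xab: "a \<le> x" "x \<le> b" using x by (auto simp: I_eq)
  have "integral {a..b} ?G = integral {a..x} ?G + integral {x..b} ?G"
    using Henstock_Kurzweil_Integration.integral_combine[OF xab L2_HK_integrable[OF wt_L2[OF green_f_L2]]] by simp
  moreover have "integral {a..x} ?G = integral {a..x} (\<lambda>y. chi x * (phi y * F y))"
    by (rule integral_cong) (simp add: green_def F_def)
  \<comment> \<open>Discarding the point \<open>x\<close> leaves only the branch
    \<open>x < y\<close>.\<close>
  moreover have "integral {x..b} ?G = integral {x..b} (\<lambda>y. phi x * (chi y * F y))"
    by (rule integral_spike[of "{x}"]) (auto simp: green_def F_def)
  moreover have "integral {x..b} (\<lambda>y. chi y * F y) =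
      integral {a..b} (\<lambda>y. chi y * F y) - integral {a..x} (\<lambda>y. chi y * F y)"
    using Henstock_Kurzweil_Integration.integral_combine[OF xab L2_HK_integrable[OF chi_F_L2]]
    by (simp add: algebra_simps)
  ultimately have "integral {a..b} ?G = chi x * coef_chi x +
      phi x * (coef_phi x - f1 / (of_real (D1 P * D2 P) * omega P phi chi))"
    by (simp add: coef_chi_def coef_phi_def)
  then show ?thesis
    unfolding weighted_integral_split[OF green_f_L2] sol_def by (simp add: algebra_simps)
qed

end

theorem mainTheorem3:
  fixes P :: SL_data and lam f1 :: complex and phi chi f :: "real \<Rightarrow> complex"
  assumes "SL_problem P"
    and "is_phi P lam phi"
    and "is_chi P lam chi"
    and "\<not> eigenvalue_A P lam"
    and "f \<in> L2 P"
  shows "omega P phi chi \<noteq> 0 \<and>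
    bij_betw (lam_minus_A P lam) (dom_A P) (H_space P) \<and>
    (\<exists>u \<in> dom_funs P.
       the_inv_into (dom_A P) (lam_minus_A P lam) (cls P f, f1) = (cls P u, R'_form P u) \<and>
       lam_minus_A P lam (cls P u, R'_form P u) = (cls P f, f1) \<and>
       (\<forall>x \<in> I_dom P. u x =
          (LINT y|lebesgue_on (I1 P). green P phi chi x y * f y) +
          of_real (1 / D1 P) * (LINT y|lebesgue_on (I2 P). green P phi chi x y * f y) +
          of_real (1 / (D1 P * D2 P)) * (LINT y|lebesgue_on (I3 P). green P phi chi x y * f y) +
          f1 * phi x / (of_real (D1 P * D2 P) * omega P phi chi)))"
proof -
  interpret SL_transmission P by unfold_locales fact
  have omega: "omega P phi chi \<noteq> 0"
    using assms by (intro omega_neq_0)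
  \<comment> \<open>The locale predicate takes only the parameters its assumptions mention, so this
    one fact serves every second component.\<close>
  have resolvent: "SL_resolvent P lam phi chi g" if "g \<in> L2 P" for g
    using assms omega that by unfold_locales
  have inj: "inj_on (lam_minus_A P lam) (dom_A P)"
  proof (rule inj_onI)
    fix U V assume "U \<in> dom_A P" "V \<in> dom_A P" and eq: "lam_minus_A P lam U = lam_minus_A P lam V"
    then obtain u v where u: "u \<in> dom_funs P" "U = (cls P u, R'_form P u)"
      and v: "v \<in> dom_funs P" "V = (cls P v, R'_form P v)"
      unfolding dom_A_def by blast
    define w where "w = (\<lambda>x. u x - v x)"
    note w = dom_funs_diff[OF u(1) v(1), folded w_def]
    have "cls P (\<lambda>x. lam * u x - tau P u x) = cls P (\<lambda>x. lam * v x - tau P v x)"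
      and R: "lam * R'_form P u + R_form P u = lam * R'_form P v + R_form P v"
      using eq by (simp_all add: u v lam_minus_A_cls)
    then have "AE x in lebesgue_on {a_pt P..b_pt P}. lam * u x - tau P u x = lam * v x - tau P v x"
      using dom_funs_L2 u v by (subst (asm) cls_eq_iff) (auto intro!: L2_diff L2_cmult)
    with w(2) have "AE x in lebesgue_on {a_pt P..b_pt P}. tau P w x = lam * w x"
    proof eventually_elim
      fix x assume "tau P w x = tau P u x - tau P v x"
        and "lam * u x - tau P u x = lam * v x - tau P v x"
      then have "tau P w x = lam * u x - lam * v x" by algebra
      then show "tau P w x = lam * w x" by (simp add: w_def right_diff_distrib)
    qed
    moreover have "lam * R'_form P w + R_form P w = 0"
      using R unfolding w by (simp add: algebra_simps)
    ultimately have ae: "AE x in lebesgue_on {a_pt P..b_pt P}. w x = 0"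
      by (rule AE_eq_0_if_not_eigenvalue[OF assms(4) w(1)])
    then have "AE x in lebesgue_on {a_pt P..b_pt P}. u x = v x"
      by eventually_elim (simp add: w_def)
    then have c: "cls P u = cls P v"
      using cls_cong_AE dom_funs_L2(1)[OF u(1)] by blast
    \<comment> \<open>Equal classes of domain functions mean equal values on \<open>I\<close>, so
      the second component is determined by the first.\<close>
    have "R'_form P u = R'_form P v"
      by (rule R_form_cong(2)) (rule dom_funs_cls_eq_imp_eq[OF u(1) v(1) c])
    with c show "U = V" by (simp add: u v)
  qed
  \<comment> \<open>Variation of parameters applies to every vector of \<open>H\<close>, once a
    representative of its first component is fixed.\<close>
  have surj: "lam_minus_A P lam ` dom_A P = H_space P"
  proof
    show "lam_minus_A P lam ` dom_A P \<subseteq> H_space P"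
      unfolding dom_A_def H_space_eq
      by (auto simp: lam_minus_A_cls intro!: imageI L2_diff L2_cmult intro: dom_funs_L2)
    show "H_space P \<subseteq> lam_minus_A P lam ` dom_A P"
    proof
      fix G assume "G \<in> H_space P"
      then obtain g g1 where g: "g \<in> L2 P" "G = (cls P g, g1)"
        unfolding H_space_eq by blast
      interpret g: SL_resolvent P lam g1 phi chi g by (rule resolvent[OF g(1)])
      show "G \<in> lam_minus_A P lam ` dom_A P"
        using g.lam_minus_A_sol g.sol_in_dom_funs unfolding g(2) dom_A_def
        by (intro image_eqI[of _ _ "(cls P g.sol, R'_form P g.sol)"]) auto
    qed
  qed
  interpret f: SL_resolvent P lam f1 phi chi f by (rule resolvent[OF assms(5)])
  have "the_inv_into (dom_A P) (lam_minus_A P lam) (cls P f, f1) = (cls P f.sol, R'_form P f.sol)"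
    using f.sol_in_dom_funs by (intro the_inv_into_f_eq inj f.lam_minus_A_sol) (auto simp: dom_A_def)
  then show ?thesis
    using omega inj surj f.sol_in_dom_funs f.lam_minus_A_sol f.sol_eq_green
    by (auto simp: bij_betw_def)
qed

end
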